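(* Let $N\ge2$ and let $D\subset\mathbb{R}^N$ be a bounded domain with $0\in D$ and boundary $\partial D$ of class $C^{2,\alpha}$ for some $0<\alpha<1$. Let $\sigma_+,\sigma_-$ be positive constants with $\sigma_+\neq\sigma_-$ and set $\sigma(x)=\sigma_+$ for $x\in D$, $\sigma(x)=\sigma_-$ for $x\in\mathbb{R}^N\setminus D$. Let $\psi\in C^2(\bar D)\cap C(\mathbb{R}^N)$ satisfy: $\max\psi>0$, $\psi$ is radially symmetric with respect to the origin, and $\overline{\{x\in\mathbb{R}^N:\psi(x)>0\}}\subset D$. Let $L>0$ be such that $\bar D\subset B_L(0)$. Let $u\in C^{1,1}(\bar D)\cap C^{0,1}(\overline{B_L(0)})$ be the solution of $$\min\{-\operatorname{div}(\sigma\nabla u),\,u-\psi\}=0\text{ in }B_L(0),\qquad u=0\text{ on }\partial B_L(0),$$ and suppose that in addition $u=d$ on $\partial D$ for some constant $d>0$. Then $u$ is radially symmetric with respect to the origin and $D$ is a ball centered at the origin.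
   Context: $B_r(z)$ denotes the open ball of radius $r$ centered at $z$. The obstacle problem $\min\{-\operatorname{div}(\sigma\nabla u),u-\psi\}=0$ in $B_L(0)$, $u=0$ on $\partial B_L(0)$ is understood as: $u\ge\psi$, $-\operatorname{div}(\sigma\nabla u)\ge0$ in the weak sense in $B_L(0)$, $-\operatorname{div}(\sigma\nabla u)=0$ in the weak sense in $\{u>\psi\}$, $u=0$ on $\partial B_L(0)$; equivalently, $u$ is the unique minimizer of $\int_{B_L(0)}\sigma|\nabla w|^2\,dx$ over $\{w\in H^1_0(B_L(0)): w\ge\psi\text{ a.e.}\}$. *)

theory Defs
  imports "HOL-Analysis.Analysis"
begin

definition pd :: "'n::finite \<Rightarrow> (real^'n \<Rightarrow> real) \<Rightarrow> real^'n \<Rightarrow> real" where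
  "pd i f x = deriv (\<lambda>t. f (x + t *\<^sub>R axis i 1)) 0"

definition has_pd :: "'n::finite \<Rightarrow> (real^'n \<Rightarrow> real) \<Rightarrow> real^'n \<Rightarrow> bool" where
  "has_pd i f x \<longleftrightarrow> (\<lambda>t. f (x + t *\<^sub>R axis i 1)) field_differentiable (at 0)"

fun iter_pd :: "'n::finite list \<Rightarrow> (real^'n \<Rightarrow> real) \<Rightarrow> real^'n \<Rightarrow> real" where
  "iter_pd [] f = f"
| "iter_pd (i # is) f = pd i (iter_pd is f)"

definition grad :: "(real^'n::finite \<Rightarrow> real) \<Rightarrow> real^'n \<Rightarrow> real^'n" where
  "grad f x = (\<chi> i. pd i f x)"

definition Ck_on :: "nat \<Rightarrow> (real^'n::finite) set \<Rightarrow> (real^'n \<Rightarrow> real) \<Rightarrow> bool" where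
  "Ck_on k U f \<longleftrightarrow>
     (\<forall>is. length is \<le> k \<longrightarrow> continuous_on U (iter_pd is f)) \<and>
     (\<forall>is. length is < k \<longrightarrow> (\<forall>i. \<forall>x\<in>U. has_pd i (iter_pd is f) x))"

text \<open>C^k(closure U) for a bounded open U: C^k in U with all derivatives up to order k
  uniformly continuous on U (i.e. extending continuously to the closure).\<close>
definition Ck_closure :: "nat \<Rightarrow> (real^'n::finite) set \<Rightarrow> (real^'n \<Rightarrow> real) \<Rightarrow> bool" where
  "Ck_closure k U f \<longleftrightarrow> Ck_on k U f \<and>
     (\<forall>is. length is \<le> k \<longrightarrow> uniformly_continuous_on U (iter_pd is f))"

definition C11_closure :: "(real^'n::finite) set \<Rightarrow> (real^'n \<Rightarrow> real) \<Rightarrow> bool" where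
  "C11_closure U f \<longleftrightarrow> Ck_closure 1 U f \<and>
     (\<exists>M. (\<forall>i. M-lipschitz_on U (pd i f)) \<and> (\<exists>M'. M'-lipschitz_on U f))"

definition C01 :: "(real^'n::finite) set \<Rightarrow> (real^'n \<Rightarrow> real) \<Rightarrow> bool" where
  "C01 S f \<longleftrightarrow> (\<exists>M. M-lipschitz_on S f)"

definition holder_on :: "real \<Rightarrow> (real^'n::finite) set \<Rightarrow> (real^'n \<Rightarrow> real) \<Rightarrow> bool" where
  "holder_on \<alpha> S f \<longleftrightarrow> (\<exists>C. \<forall>x\<in>S. \<forall>y\<in>S. \<bar>f x - f y\<bar> \<le> C * dist x y powr \<alpha>)"

definition C2alpha_on :: "real \<Rightarrow> (real^'n::finite) set \<Rightarrow> (real^'n \<Rightarrow> real) \<Rightarrow> bool" where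
  "C2alpha_on \<alpha> S f \<longleftrightarrow> Ck_closure 2 S f \<and>
     (\<forall>is. length is \<le> 2 \<longrightarrow> bounded (iter_pd is f ` S)) \<and>
     (\<forall>is. length is = 2 \<longrightarrow> holder_on \<alpha> S (iter_pd is f))"

definition C2alpha_boundary :: "real \<Rightarrow> (real^'n::finite) set \<Rightarrow> bool" where
  "C2alpha_boundary \<alpha> D \<longleftrightarrow>
     (\<forall>p\<in>frontier D. \<exists>r>0. \<exists>k. \<exists>\<gamma>::real^'n \<Rightarrow> real. \<exists>s::real. (s = 1 \<or> s = -1) \<and>
        (\<forall>x y. (\<forall>j. j \<noteq> k \<longrightarrow> x $ j = y $ j) \<longrightarrow> \<gamma> x = \<gamma> y) \<and>
        C2alpha_on \<alpha> (ball p r) \<gamma> \<and>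
        D \<inter> ball p r = {x \<in> ball p r. s * (x $ k - \<gamma> x) > 0} \<and>
        frontier D \<inter> ball p r = {x \<in> ball p r. x $ k = \<gamma> x})"

definition csupport :: "(real^'n::finite \<Rightarrow> real) \<Rightarrow> (real^'n) set" where
  "csupport f = closure {x. f x \<noteq> 0}"

definition smooth :: "(real^'n::finite \<Rightarrow> real) \<Rightarrow> bool" where
  "smooth f \<longleftrightarrow> (\<forall>is. continuous_on UNIV (iter_pd is f) \<and> (\<forall>i x. has_pd i (iter_pd is f) x))"

definition test_fun :: "(real^'n::finite) set \<Rightarrow> (real^'n \<Rightarrow> real) \<Rightarrow> bool" where
  "test_fun U \<phi> \<longleftrightarrow> smooth \<phi> \<and> compact (csupport \<phi>) \<and> csupport \<phi> \<subseteq> U"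

definition weak_grad_on :: "(real^'n::finite) set \<Rightarrow> (real^'n \<Rightarrow> real) \<Rightarrow> (real^'n \<Rightarrow> real^'n) \<Rightarrow> bool" where
  "weak_grad_on U u G \<longleftrightarrow>
     (\<forall>K i. compact K \<and> K \<subseteq> U \<longrightarrow> (\<lambda>x. G x $ i) absolutely_integrable_on K) \<and>
     (\<forall>\<phi> i. test_fun U \<phi> \<longrightarrow>
        integral U (\<lambda>x. u x * pd i \<phi> x) = - integral U (\<lambda>x. G x $ i * \<phi> x))"

text \<open>Weak formulation of the obstacle problem min{-div(sigma grad u), u - psi} = 0 in U,
  u = 0 on the boundary of U.\<close>
definition obstacle_solution ::
  "(real^'n::finite \<Rightarrow> real) \<Rightarrow> (real^'n \<Rightarrow> real) \<Rightarrow> (real^'n) set \<Rightarrow> (real^'n \<Rightarrow> real) \<Rightarrow> bool" where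
  "obstacle_solution \<sigma> \<psi> U u \<longleftrightarrow>
     (\<forall>x\<in>U. u x \<ge> \<psi> x) \<and>
     (\<forall>x\<in>frontier U. u x = 0) \<and>
     (\<exists>G. weak_grad_on U u G \<and>
        (\<forall>\<phi>. test_fun U \<phi> \<and> (\<forall>x. \<phi> x \<ge> 0) \<longrightarrow>
           integral U (\<lambda>x. \<sigma> x * (G x \<bullet> grad \<phi> x)) \<ge> 0) \<and>
        (\<forall>\<phi>. test_fun {x\<in>U. u x > \<psi> x} \<phi> \<longrightarrow>
           integral U (\<lambda>x. \<sigma> x * (G x \<bullet> grad \<phi> x)) = 0))"

definition radial :: "(real^'n::finite \<Rightarrow> 'a) \<Rightarrow> (real^'n) set \<Rightarrow> bool" where
  "radial f S \<longleftrightarrow> (\<forall>x\<in>S. \<forall>y\<in>S. norm x = norm y \<longrightarrow> f x = f y)"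

end

theory Submission
  imports Defs "HOL-Computational_Algebra.Polynomial"
begin

text \<open>Since \<open>u = d\<close> on the interface, the function equal to \<open>\<sigma>m d + \<sigma>p (u - d)\<close> in \<open>D\<close> and to
  \<open>\<sigma>m u\<close> outside is continuous, and its distributional Laplacian is the divergence of \<open>\<sigma> \<nabla> u\<close>.
  Hence this function \<open>V\<close> is superharmonic in the whole ball, harmonic off the contact set, and zero on the
  sphere. For an orthogonal map \<open>R\<close>, a point where \<open>V \<circ> R > V\<close> is not mapped into the contact set, as the
  obstacle is radial and nonpositive off \<open>D\<close> while \<open>u > 0\<close>; so \<open>V \<circ> R - V\<close> is subharmonic where it is
  positive, and \<open>V \<circ> R \<le> V\<close> by the maximum principle. Thus \<open>V\<close> is radial, and so is \<open>D\<close>, which is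
  the set where \<open>V > \<sigma>m d\<close>.

  Superharmonicity is only used through a mean value inequality with a smooth radial kernel, which is
  visibly invariant under orthogonal maps.\<close>

subsection \<open>Smooth bump functions\<close>

text \<open>The equation is given only through integrals against smooth test functions, with a
  locally integrable weak gradient, so the mean value inequality has to come from an explicit test
  function. This fixes the kernel. With F(s) = exp(-1/(1-s)), continued by 0 from s = 1 on, the
  kernel -F'(|x-a|^2/t^2), scaled by t^(-N), has as its t-derivative a positive multiple of the
  Laplacian of F(|x-a|^2/t^2), which is itself an admissible nonnegative test function. Monotonicity
  of the means in t is then the weak inequality itself, and neither spherical means nor
  mollification enters.

  The other obstacle is the interface: the weak gradient carries no traces there, so no flux through
  it can be written down. Instead \<open>u - d\<close>, which vanishes on the interface, is extended
  by zero from \<open>D\<close>, and its weak gradient is shown to be the restriction of the given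
  one. Cutoffs near the interface have unbounded derivatives; these are never estimated, because a
  Lipschitz function pairs with a derivative at a cost depending only on the mass of the test
  function.\<close>

definition flat :: "real poly \<Rightarrow> real \<Rightarrow> real" where
  "flat p s = (if s < 1 then poly p (1 / (1 - s)) * exp (- (1 / (1 - s))) else 0)"

text \<open>With z = 1/(1-s) one has dz/ds = z^2, so differentiating p(z) exp(-z) gives (p' - p)(z)
  z^2 exp(-z). Carrying a polynomial factor makes the flat profiles closed under differentiation, so
  one derivative rule serves all orders.\<close>

definition flat_deriv :: "real poly \<Rightarrow> real poly" where
  "flat_deriv p = (pderiv p - p) * monom 1 2"

lemma poly_exp_tendsto_0: "((\<lambda>z::real. poly p z * exp (- z)) \<longlongrightarrow> 0) at_top"
proof -
  have "((\<lambda>z. \<Sum>i\<le>degree p. coeff p i * (z ^ i / exp z)) \<longlongrightarrow> (\<Sum>i\<le>degree p. coeff p i * 0)) at_top"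
    by (intro tendsto_intros tendsto_power_div_exp_0)
  moreover have "(\<lambda>z. \<Sum>i\<le>degree p. coeff p i * (z ^ i / exp z)) = (\<lambda>z. poly p z * exp (- z))"
    by (simp add: poly_altdef exp_minus sum_distrib_right divide_inverse mult.assoc)
  ultimately show ?thesis by simp
qed

lemma flat_tendsto_at_1: "(flat p \<longlongrightarrow> 0) (at 1)"
proof -
  have "filterlim (\<lambda>s::real. 1 / (1 - s)) at_top (at_left 1)"
  proof -
    have "filterlim (\<lambda>s::real. 1 - s) (at_right 0) (at_left 1)"
      unfolding filterlim_at
      by (auto simp: eventually_at_filter intro!: tendsto_eq_intros)
    then show ?thesis
      using filterlim_compose[OF filterlim_inverse_at_top_right] by (simp add: inverse_eq_divide)
  qed
  then have "((\<lambda>s. poly p (1 / (1 - s)) * exp (- (1 / (1 - s)))) \<longlongrightarrow> 0) (at_left 1)"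
    by (rule filterlim_compose[OF poly_exp_tendsto_0])
  then have l: "(flat p \<longlongrightarrow> 0) (at_left 1)"
    by (rule Lim_transform_eventually) (auto simp: flat_def eventually_at_filter)
  have "(flat p \<longlongrightarrow> 0) (at_right 1)"
    by (rule Lim_transform_eventually[where f="\<lambda>_. 0"])
      (auto simp: flat_def eventually_at_filter)
  with l show ?thesis by (simp add: filterlim_split_at)
qed

lemma flat_has_field_derivative: "(flat p has_field_derivative flat (flat_deriv p) s) (at s)"
proof (cases s "1::real" rule: linorder_cases)
  case less
  have "((\<lambda>s. poly p (1 / (1 - s)) * exp (- (1 / (1 - s)))) has_field_derivative flat (flat_deriv p) s) (at s)"
    using less
    by (auto intro!: derivative_eq_intros poly_DERIV
        simp: flat_def flat_deriv_def poly_monom field_simps power2_eq_square)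
  then show ?thesis
    by (rule has_field_derivative_transform_within_open[where S="{..<1}"])
      (use less in \<open>auto simp: flat_def\<close>)
next
  case equal
  have "((\<lambda>y. (flat p y - flat p 1) / (y - 1)) \<longlongrightarrow> 0) (at 1)"
  proof (rule Lim_transform_eventually)
    \<comment> \<open>Since \<open>flat p 1 = 0\<close> and 1/(y-1) = -z, the difference quotient at
      1 is again a flat profile, up to sign the one of z p(z), whose limit is known.\<close>
    show "((\<lambda>y. - flat (p * monom 1 1) y) \<longlongrightarrow> 0) (at 1)"
      using tendsto_minus[OF flat_tendsto_at_1[of "p * monom 1 1"]] by simp
    have "- flat (p * monom 1 1) y = (flat p y - flat p 1) / (y - 1)" if "y \<noteq> 1" for y
      using that by (auto simp: flat_def poly_monom field_simps)
    then show "\<forall>\<^sub>F y in at 1. - flat (p * monom 1 1) y = (flat p y - flat p 1) / (y - 1)"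
      by (simp add: eventually_at_filter)
  qed
  then show ?thesis
    using equal by (simp add: has_field_derivative_iff flat_def)
next
  case greater
  have "((\<lambda>_. 0) has_field_derivative flat (flat_deriv p) s) (at s)"
    using greater by (simp add: flat_def)
  then show ?thesis
    by (rule has_field_derivative_transform_within_open[where S="{1<..}"])
      (use greater in \<open>auto simp: flat_def\<close>)
qed

lemma continuous_on_flat [continuous_intros]:
  "continuous_on S f \<Longrightarrow> continuous_on S (\<lambda>x. flat p (f x))"
  by (rule continuous_on_compose2[of UNIV "flat p"])
    (auto intro!: continuous_at_imp_continuous_on DERIV_isCont flat_has_field_derivative)

text \<open>The squared norm keeps the argument polynomial in the coordinates, so nothing singular
  happens at the centre. The case \<open>p = 1\<close> is the usual bump; other \<open>p\<close>
  arise from its derivatives.\<close>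

definition bump :: "real poly \<Rightarrow> real^'n \<Rightarrow> real \<Rightarrow> real^'n::finite \<Rightarrow> real" where
  "bump p a t x = flat p ((x - a) \<bullet> (x - a) / t\<^sup>2)"

section \<open>Partial derivatives and smoothness\<close>

lemma has_pd_pd: "has_pd i f x \<longleftrightarrow> ((\<lambda>t. f (x + t *\<^sub>R axis i 1)) has_field_derivative pd i f x) (at 0)"
  by (simp add: has_pd_def pd_def DERIV_deriv_iff_field_differentiable)

lemma has_pdI:
  assumes "((\<lambda>t. f (x + t *\<^sub>R axis i 1)) has_field_derivative D) (at 0)"
  shows "has_pd i f x" "pd i f x = D"
  using assms by (auto simp: has_pd_def pd_def field_differentiable_def DERIV_imp_deriv)

lemma bump_pd:
  assumes "t \<noteq> 0"
  shows "has_pd i (bump p a t) x"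
    and "pd i (bump p a t) x = (2 / t\<^sup>2) * (x $ i - a $ i) * bump (flat_deriv p) a t x"
proof -
  have e: "(x + h *\<^sub>R axis i 1 - a) \<bullet> (x + h *\<^sub>R axis i 1 - a)
      = (x - a) \<bullet> (x - a) + 2 * h * (x $ i - a $ i) + h\<^sup>2" for h
    by (simp add: algebra_simps inner_axis inner_axis' power2_eq_square inner_commute)
  have "((\<lambda>h. flat p (((x - a) \<bullet> (x - a) + 2 * h * (x $ i - a $ i) + h\<^sup>2) / t\<^sup>2))
      has_field_derivative (2 / t\<^sup>2) * (x $ i - a $ i) * bump (flat_deriv p) a t x) (at 0)"
    by (rule DERIV_chain2[where f="flat p", THEN DERIV_cong, OF flat_has_field_derivative])
      (use assms in \<open>auto intro!: derivative_eq_intros simp: bump_def field_simps\<close>)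
  then have *: "((\<lambda>h. bump p a t (x + h *\<^sub>R axis i 1)) has_field_derivative
      (2 / t\<^sup>2) * (x $ i - a $ i) * bump (flat_deriv p) a t x) (at 0)"
    by (simp add: bump_def e)
  show "has_pd i (bump p a t) x"
    and "pd i (bump p a t) x = (2 / t\<^sup>2) * (x $ i - a $ i) * bump (flat_deriv p) a t x"
    using has_pdI[OF *] by auto
qed

text \<open>\<open>iter_pd\<close> applies the head of the list last, so the derivative taken first
  sits at the end of the list.\<close>

lemma iter_pd_snoc: "iter_pd (is @ [i]) f = iter_pd is (pd i f)"
  by (induction "is") auto

lemma smooth_pd: "smooth f \<Longrightarrow> smooth (pd i f)"
  unfolding smooth_def by (metis iter_pd_snoc)

lemma smooth_D:
  assumes "smooth f" shows "continuous_on S f" "has_pd i f x"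
proof -
  have "continuous_on UNIV (iter_pd [] f)" "has_pd i (iter_pd [] f) x"
    using assms unfolding smooth_def by blast+
  then show "continuous_on S f" "has_pd i f x" by (auto intro: continuous_on_subset)
qed

text \<open>A class of functions closed under partial derivatives; smoothness of products, sums and
  bumps is obtained from this single closure property.\<close>

inductive pd_stable :: "(real^'n::finite \<Rightarrow> real) \<Rightarrow> bool" where
  pd_stable_smooth: "smooth f \<Longrightarrow> pd_stable f"
| pd_stable_const: "pd_stable (\<lambda>x. c)"
| pd_stable_coord: "pd_stable (\<lambda>x. x $ i - c)"
| pd_stable_bump: "t \<noteq> 0 \<Longrightarrow> pd_stable (bump p a t)"
| pd_stable_add: "pd_stable f \<Longrightarrow> pd_stable g \<Longrightarrow> pd_stable (\<lambda>x. f x + g x)"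
| pd_stable_mult: "pd_stable f \<Longrightarrow> pd_stable g \<Longrightarrow> pd_stable (\<lambda>x. f x * g x)"

lemma pd_add:
  assumes "has_pd i f x" "has_pd i g x"
  shows "has_pd i (\<lambda>x. f x + g x) x" "pd i (\<lambda>x. f x + g x) x = pd i f x + pd i g x"
  using has_pdI[OF DERIV_add[OF assms[unfolded has_pd_pd]]] by auto

lemma pd_mult:
  assumes "has_pd i f x" "has_pd i g x"
  shows "has_pd i (\<lambda>x. f x * g x) x" "pd i (\<lambda>x. f x * g x) x = pd i f x * g x + f x * pd i g x"
  using has_pdI[OF DERIV_mult[OF assms[unfolded has_pd_pd]]] by (auto simp: algebra_simps)

lemma pd_const: "has_pd i (\<lambda>x. c) x" "pd i (\<lambda>x. c) = (\<lambda>x. 0)"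
  by (auto intro!: has_pdI derivative_eq_intros ext)

lemma pd_coord:
  fixes x :: "real^'n::finite"
  shows "has_pd i (\<lambda>x. x $ j - c) x" "pd i (\<lambda>x. x $ j - c) x = (if i = j then 1 else 0)"
proof -
  have "((\<lambda>t. (x + t *\<^sub>R axis i 1) $ j - c) has_field_derivative (if i = j then 1 else 0)) (at 0)"
    by (auto intro!: derivative_eq_intros simp: axis_def)
  from has_pdI[OF this] show "has_pd i (\<lambda>x. x $ j - c) x" "pd i (\<lambda>x. x $ j - c) x = (if i = j then 1 else 0)"
    by auto
qed

lemma pd_stable_pd: "pd_stable f \<Longrightarrow> continuous_on UNIV f \<and> (\<forall>i. (\<forall>x. has_pd i f x) \<and> pd_stable (pd i f))"
proof (induction rule: pd_stable.induct)
  case (pd_stable_smooth f)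
  then show ?case by (auto intro: smooth_D pd_stable.pd_stable_smooth smooth_pd)
next
  case (pd_stable_const c)
  then show ?case by (auto simp: pd_const intro: pd_stable.pd_stable_const)
next
  case (pd_stable_coord i c)
  have "pd j (\<lambda>x. x $ i - c) = (\<lambda>x. if j = i then 1 else 0)" for j
    using pd_coord(2) by (intro ext)
  then show ?case
    by (auto intro!: continuous_intros pd_coord pd_stable.pd_stable_const)
next
  case (pd_stable_bump t p a)
  have "pd i (bump p a t) = (\<lambda>x. ((2 / t\<^sup>2) * (x $ i - a $ i)) * bump (flat_deriv p) a t x)" for i
    using bump_pd(2)[OF pd_stable_bump] by (intro ext) auto
  moreover have "continuous_on UNIV (bump p a t)"
    unfolding bump_def[abs_def] using pd_stable_bump by (auto intro!: continuous_intros)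
  moreover have "pd_stable (\<lambda>x. ((2 / t\<^sup>2) * (x $ i - a $ i)) * bump (flat_deriv p) a t x)" for i
    by (rule pd_stable.pd_stable_mult, rule pd_stable.pd_stable_mult, rule pd_stable.pd_stable_const, rule pd_stable.pd_stable_coord, rule pd_stable.pd_stable_bump, rule pd_stable_bump)
  ultimately show ?case
    using bump_pd(1)[OF pd_stable_bump] by metis
next
  case (pd_stable_add f g)
  then have "pd i (\<lambda>x. f x + g x) = (\<lambda>x. pd i f x + pd i g x)" for i
    by (intro ext pd_add) auto
  with pd_stable_add show ?case
    by (auto intro!: continuous_intros pd_add pd_stable.pd_stable_add)
next
  case (pd_stable_mult f g)
  then have "pd i (\<lambda>x. f x * g x) = (\<lambda>x. pd i f x * g x + f x * pd i g x)" for i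
    by (intro ext pd_mult) auto
  with pd_stable_mult show ?case
    by (auto intro!: continuous_intros pd_mult pd_stable.pd_stable_add pd_stable.pd_stable_mult)
qed

lemma pd_stable_imp_smooth: assumes "pd_stable f" shows "smooth f"
proof -
  have "pd_stable (iter_pd is f)" for "is"
    using assms by (induction "is") (auto simp: pd_stable_pd)
  then show ?thesis unfolding smooth_def using pd_stable_pd by blast
qed

lemma smooth_mult: "smooth f \<Longrightarrow> smooth g \<Longrightarrow> smooth (\<lambda>x. f x * g x)"
  by (rule pd_stable_imp_smooth, rule pd_stable_mult) (auto intro: pd_stable_smooth)

lemma smooth_const: "smooth (\<lambda>x. c)"
  by (rule pd_stable_imp_smooth, rule pd_stable_const)

lemma smooth_one_minus: assumes "smooth f" shows "smooth (\<lambda>x. 1 - f x)"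
proof -
  have "smooth (\<lambda>x. 1 + (-1) * f x)"
    by (rule pd_stable_imp_smooth, rule pd_stable_add, rule pd_stable_const, rule pd_stable_mult, rule pd_stable_const, rule pd_stable_smooth, rule assms)
  then show ?thesis by simp
qed

lemma smooth_power: "smooth f \<Longrightarrow> smooth (\<lambda>x. f x ^ n)"
  by (induction n) (auto intro: smooth_const smooth_mult)

lemma smooth_prod: 
  fixes f :: "nat \<Rightarrow> real^'n::finite \<Rightarrow> real"
  assumes "\<And>j. smooth (f j)" shows "smooth (\<lambda>x. \<Prod>j<n. f j x)"
  using assms by (induction n) (auto intro: smooth_const smooth_mult)

lemma smooth_bump: "t \<noteq> 0 \<Longrightarrow> smooth (bump p a t)"
  by (rule pd_stable_imp_smooth, rule pd_stable_bump)

lemma continuous_on_bump: "t \<noteq> 0 \<Longrightarrow> continuous_on S (bump p a t)"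
  by (intro smooth_D smooth_bump)

lemma bump_eq_0: assumes "x \<notin> ball a t" "t > 0" shows "bump p a t x = 0"
proof -
  have "t\<^sup>2 \<le> (x - a) \<bullet> (x - a)"
    using assms by (auto simp: dist_norm norm_minus_commute power2_norm_eq_inner[symmetric] intro!: power_mono)
  then show ?thesis using assms by (simp add: bump_def flat_def)
qed

lemma inner_div_less_1: assumes "x \<in> ball a t" shows "(x - a) \<bullet> (x - a) / t\<^sup>2 < 1"
proof -
  have "norm (x - a) < t" using assms by (auto simp: dist_norm norm_minus_commute)
  moreover from this have "0 < t" by (rule le_less_trans[OF norm_ge_zero])
  ultimately have "(x - a) \<bullet> (x - a) < t\<^sup>2"
    by (auto simp: power2_norm_eq_inner[symmetric] intro!: power_strict_mono)
  then show ?thesis using \<open>0 < t\<close> by simp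
qed

section \<open>Supports and test functions\<close>

lemma csupport_bump: assumes "t > 0" shows "csupport (bump p a t) \<subseteq> cball a t"
proof -
  have "{x. bump p a t x \<noteq> 0} \<subseteq> ball a t" using bump_eq_0[OF _ assms] by blast
  then show ?thesis
    unfolding csupport_def by (meson ball_subset_cball closed_cball closure_minimal subset_trans)
qed

lemma test_fun_subset:
  assumes "smooth f" "csupport f \<subseteq> K" "compact K" "K \<subseteq> U" shows "test_fun U f"
proof -
  have "bounded (csupport f)" using assms(2,3) by (meson bounded_subset compact_imp_bounded)
  then have "compact (csupport f)" by (simp add: compact_eq_bounded_closed csupport_def)
  then show ?thesis using assms by (auto simp: test_fun_def)
qed

lemma test_fun_bump: assumes "t > 0" "cball a t \<subseteq> U" shows "test_fun U (bump p a t)"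
  using assms by (intro test_fun_subset[OF smooth_bump csupport_bump]) auto

lemma not_csupport: "x \<notin> csupport f \<Longrightarrow> f x = 0"
  unfolding csupport_def using closure_subset[of "{x. f x \<noteq> 0}"] by auto

lemma csupport_pd: "csupport (pd i f) \<subseteq> csupport f"
proof -
  have "pd i f x = 0" if x: "x \<notin> csupport f" for x
  proof -
    have "open (- csupport f)" by (simp add: csupport_def open_Compl)
    then obtain e where e: "e > 0" "ball x e \<subseteq> - csupport f"
      using x by (metis ComplI openE)
    have fz: "f (x + t *\<^sub>R axis i 1) = 0" if "t \<in> ball 0 e" for t
    proof -
      have "x + t *\<^sub>R axis i 1 \<in> ball x e" using that by (simp add: dist_norm)
      then have "x + t *\<^sub>R axis i 1 \<notin> csupport f" using e by blast
      then show ?thesis by (rule not_csupport)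
    qed
    have "((\<lambda>t. f (x + t *\<^sub>R axis i 1)) has_field_derivative 0) (at 0)"
      by (rule has_field_derivative_transform_within_open[where f="\<lambda>_. 0" and S="ball 0 e", OF DERIV_const open_ball])
        (use e fz in auto)
    then show ?thesis by (rule has_pdI)
  qed
  then have "{x. pd i f x \<noteq> 0} \<subseteq> csupport f" by auto
  then have "closure {x. pd i f x \<noteq> 0} \<subseteq> csupport f"
    by (rule closure_minimal) (simp add: csupport_def)
  then show ?thesis by (simp only: csupport_def)
qed

lemma test_fun_pd: assumes "test_fun U f" shows "test_fun U (pd i f)"
  using assms by (intro test_fun_subset[OF smooth_pd csupport_pd]) (auto simp: test_fun_def)

lemma csupport_mult: "csupport (\<lambda>x. f x * g x) \<subseteq> csupport f"
  unfolding csupport_def by (intro closure_mono) auto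

text \<open>Radial Laplacian in the variable s = |x-a|^2/t^2, namely (2/t^2)(N F' + 2 s F''): the
  first term collects the N second derivatives of the squared norm, the second the squares of its
  first derivatives. The same combination appears when the scaled kernel is differentiated in
  \<open>t\<close>.\<close>

lemma laplacian_bump:
  fixes a :: "real^'n::finite"
  assumes "t \<noteq> 0"
  shows "(\<Sum>i\<in>UNIV. pd i (pd i (bump p a t)) x) = (2 / t\<^sup>2) *
    (real CARD('n) * bump (flat_deriv p) a t x
     + 2 * ((x - a) \<bullet> (x - a) / t\<^sup>2) * bump (flat_deriv (flat_deriv p)) a t x)"
proof -
  have "pd i (pd i (bump p a t)) x = (2 / t\<^sup>2) * (bump (flat_deriv p) a t x
       + 2 * (x $ i - a $ i)\<^sup>2 / t\<^sup>2 * bump (flat_deriv (flat_deriv p)) a t x)" for i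
  proof -
    let ?c = "\<lambda>x. (2 / t\<^sup>2)" and ?l = "\<lambda>x. x $ i - a $ i" and ?b = "bump (flat_deriv p) a t"
    have "pd i (bump p a t) = (\<lambda>x. ?c x * ?l x * ?b x)"
      using bump_pd(2)[OF assms] by (intro ext) auto
    moreover have "pd i (\<lambda>x. ?c x * ?l x * ?b x) x = pd i (\<lambda>x. ?c x * ?l x) x * ?b x + ?c x * ?l x * pd i ?b x"
      by (intro pd_mult bump_pd assms pd_coord pd_const)
    moreover have "pd i (\<lambda>x. ?c x * ?l x) x = pd i ?c x * ?l x + ?c x * pd i ?l x"
      by (intro pd_mult bump_pd assms pd_coord pd_const)
    ultimately show ?thesis
      by (simp add: pd_const pd_coord bump_pd[OF assms] power2_eq_square field_simps add_divide_distrib diff_divide_distrib)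
  qed
  moreover have "(\<Sum>i\<in>UNIV. (x $ i - a $ i)\<^sup>2) = (x - a) \<bullet> (x - a)"
    by (simp add: inner_vec_def power2_eq_square)
  ultimately show ?thesis
    by (simp add: sum.distrib sum_distrib_left[symmetric] sum_distrib_right[symmetric] sum_divide_distrib[symmetric])
qed

subsection \<open>Difference quotients and the mean value kernel\<close>

lemma compact_support_integrable_lborel:
  fixes f :: "'a::euclidean_space \<Rightarrow> real"
  assumes "continuous_on UNIV f" "bounded S" "\<And>x. x \<notin> S \<Longrightarrow> f x = 0"
  shows "integrable lborel f"
proof -
  obtain R where R: "S \<subseteq> cball 0 R" using assms(2) bounded_subset_ballD[of S 0] ball_subset_cball by (metis subset_trans)
  have "integrable lborel (\<lambda>x. indicator (cball 0 R) x *\<^sub>R f x)"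
    using assms(1) by (intro borel_integrable_compact) (auto intro: continuous_on_subset)
  moreover have "(\<lambda>x. indicator (cball 0 R) x *\<^sub>R f x) = f"
    using assms(3) R by (force simp: indicator_def fun_eq_iff subset_eq)
  ultimately show ?thesis by simp
qed

lemma compact_support_absolutely_integrable:
  fixes f :: "'a::euclidean_space \<Rightarrow> real"
  assumes "continuous_on UNIV f" "bounded S" "\<And>x. x \<notin> S \<Longrightarrow> f x = 0"
  shows "f absolutely_integrable_on UNIV"
proof -
  have "integrable lborel f" by (rule compact_support_integrable_lborel[OF assms])
  then have "integrable lebesgue f"
    by (metis integrable_completion borel_measurable_integrable)
  then show ?thesis by (simp add: set_integrable_def)
qed

lemma integral_translation:
  fixes f :: "'a::euclidean_space \<Rightarrow> real"
  assumes "integrable lborel f"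
  shows "integral UNIV (\<lambda>x. f (c + x)) = integral UNIV f"
proof -
  have f: "f \<in> borel_measurable borel" using assms by simp
  have "integrable lborel (\<lambda>x. f (c + x))"
    using assms integrable_distr_eq[of "(+) c" lborel borel f] f by (simp add: lborel_distr_plus)
  moreover have "(\<integral>x. f (c + x) \<partial>lborel) = (\<integral>x. f x \<partial>lborel)"
    using integral_distr[of "(+) c" lborel borel f] f by (simp add: lborel_distr_plus)
  ultimately show ?thesis using assms by (simp add: integral_lborel)
qed

text \<open>\<open>has_pd\<close> speaks only of parameter 0; moving the base point along the line
  gives the derivative at every parameter, as the mean value theorem requires.\<close>

lemma pd_line:
  assumes "smooth \<phi>"
  shows "((\<lambda>t. \<phi> (x + t *\<^sub>R axis i 1)) has_field_derivative pd i \<phi> (x + s *\<^sub>R axis i 1)) (at s)"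
proof -
  have "((\<lambda>t. \<phi> ((x + s *\<^sub>R axis i 1) + t *\<^sub>R axis i 1)) has_field_derivative pd i \<phi> (x + s *\<^sub>R axis i 1)) (at 0)"
    using smooth_D(2)[OF assms] has_pd_pd by blast
  then have "((\<lambda>t. \<phi> (x + (t + s) *\<^sub>R axis i 1)) has_field_derivative pd i \<phi> (x + s *\<^sub>R axis i 1)) (at 0)"
    by (simp add: scaleR_add_left add_ac)
  then show ?thesis
    using DERIV_shift[of "\<lambda>t. \<phi> (x + t *\<^sub>R axis i 1)" _ 0 s] by simp
qed

lemma test_fun_bounded:
  assumes "test_fun U \<phi>" obtains C where "\<And>x. \<bar>\<phi> x\<bar> \<le> C" "C \<ge> 0"
proof -
  have "continuous_on (csupport \<phi>) \<phi>" "compact (csupport \<phi>)"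
    using assms smooth_D(1) by (auto simp: test_fun_def)
  then have "bounded (\<phi> ` csupport \<phi>)" by (intro compact_imp_bounded compact_continuous_image)
  then obtain C where C: "C > 0" "\<And>x. x \<in> csupport \<phi> \<Longrightarrow> \<bar>\<phi> x\<bar> \<le> C"
    by (auto simp: bounded_pos)
  have "\<bar>\<phi> x\<bar> \<le> C" for x
    using C not_csupport[of x \<phi>] by (cases "x \<in> csupport \<phi>") auto
  then show thesis using that[of C] C by auto
qed

text \<open>Discrete integration by parts: \<open>g\<close> is merely continuous, so translation
  invariance moves the shift onto \<phi>, whose quotients converge. The step sizes are positive and
  at most 1, so all shifted supports stay in one ball.\<close>

lemma difference_quotient_pairing:
  fixes g \<phi> :: "real^'n::finite \<Rightarrow> real"
  assumes g: "continuous_on UNIV g" and \<phi>: "test_fun UNIV \<phi>"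
  defines "h n \<equiv> 1 / real (Suc n)"
  shows "(\<lambda>n. integral UNIV (\<lambda>x. (g (x + h n *\<^sub>R axis i 1) - g x) / h n * \<phi> x))
     \<longlonglongrightarrow> - integral UNIV (\<lambda>x. g x * pd i \<phi> x)"
proof -
  let ?e = "axis i 1 :: real^'n"
  have sm: "smooth \<phi>" and cs: "compact (csupport \<phi>)" using \<phi> by (auto simp: test_fun_def)
  have h: "0 < h n" "h n \<le> 1" for n by (auto simp: h_def)
  have c\<phi>: "continuous_on S \<phi>" for S using smooth_D(1)[OF sm] .
  obtain C where C: "\<And>x. \<bar>pd i \<phi> x\<bar> \<le> C" "C \<ge> 0"
    using test_fun_bounded[OF test_fun_pd[OF \<phi>]] by blast
  obtain R where R: "csupport \<phi> \<subseteq> cball 0 R" using bounded_subset_ballD[OF compact_imp_bounded[OF cs], of 0] ball_subset_cball by (metis subset_trans)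
  have z: "\<phi> x = 0" if "norm x > R" for x using R that not_csupport[of x \<phi>] by (force simp: subset_eq)
  have z': "\<phi> (x - h n *\<^sub>R ?e) = 0" if "norm x > R + 1" for x n
  proof -
    have "norm x \<le> norm (x - h n *\<^sub>R ?e) + norm (h n *\<^sub>R ?e)"
      by (metis diff_add_cancel norm_triangle_ineq)
    then show ?thesis using that h[of n] z[of "x - h n *\<^sub>R ?e"] by simp
  qed
  have "bounded (g ` cball 0 (R + 1))"
    using g by (intro compact_imp_bounded compact_continuous_image) (auto intro: continuous_on_subset)
  then obtain G where G: "G > 0" "\<And>x. x \<in> cball 0 (R + 1) \<Longrightarrow> \<bar>g x\<bar> \<le> G"
    by (auto simp: bounded_pos)
  define f where "f n x = g x * ((\<phi> (x - h n *\<^sub>R ?e) - \<phi> x) / h n)" for n x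
  have cg: "continuous_on S g" for S using g continuous_on_subset by blast
  have cg': "continuous_on UNIV (\<lambda>x. g (x + h n *\<^sub>R ?e))" for n
    by (rule continuous_on_compose2[OF g]) (auto intro!: continuous_intros)
  have c\<phi>': "continuous_on UNIV (\<lambda>x. \<phi> (x - h n *\<^sub>R ?e))" for n
    by (rule continuous_on_compose2[OF c\<phi>]) (auto intro!: continuous_intros)
  have i1: "integrable lborel (\<lambda>x. g (x + h n *\<^sub>R ?e) * \<phi> x)" for n
    using cg' c\<phi> z by (intro compact_support_integrable_lborel[where S="cball 0 R"])
      (auto intro!: continuous_intros)
  have i2: "integrable lborel (\<lambda>x. g x * \<phi> x)"
    using cg c\<phi> z by (intro compact_support_integrable_lborel[where S="cball 0 R"])
      (auto intro!: continuous_intros)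
  have i3: "integrable lborel (\<lambda>x. g x * \<phi> (x - h n *\<^sub>R ?e))" for n
    using cg c\<phi>' z' by (intro compact_support_integrable_lborel[where S="cball 0 (R+1)"])
      (auto intro!: continuous_intros)
  note io = integrable_on_lborel
  have eq: "integral UNIV (\<lambda>x. (g (x + h n *\<^sub>R ?e) - g x) / h n * \<phi> x) = integral UNIV (f n)" for n
  proof -
    have "integral UNIV (\<lambda>x. g (x + h n *\<^sub>R ?e) * \<phi> x) = integral UNIV (\<lambda>x. g x * \<phi> (x - h n *\<^sub>R ?e))"
      using integral_translation[OF i3[of n], of "h n *\<^sub>R ?e"] by (simp add: add.commute)
    then have "integral UNIV (\<lambda>x. g (x + h n *\<^sub>R ?e) * \<phi> x - g x * \<phi> x)
        = integral UNIV (\<lambda>x. g x * \<phi> (x - h n *\<^sub>R ?e) - g x * \<phi> x)"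
      using io[OF i1] io[OF i2] io[OF i3] by (simp add: integral_diff)
    then have "integral UNIV (\<lambda>x. (1 / h n) * (g (x + h n *\<^sub>R ?e) * \<phi> x - g x * \<phi> x))
        = integral UNIV (\<lambda>x. (1 / h n) * (g x * \<phi> (x - h n *\<^sub>R ?e) - g x * \<phi> x))"
      by (simp only: integral_mult_right)
    moreover have "(\<lambda>x. (g (x + h n *\<^sub>R ?e) - g x) / h n * \<phi> x) = (\<lambda>x. (1 / h n) * (g (x + h n *\<^sub>R ?e) * \<phi> x - g x * \<phi> x))"
      by (auto simp: field_simps)
    moreover have "f n = (\<lambda>x. (1 / h n) * (g x * \<phi> (x - h n *\<^sub>R ?e) - g x * \<phi> x))"
      using h[of n] by (auto simp: f_def field_simps)
    ultimately show ?thesis by simp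
  qed
  \<comment> \<open>Dominating function: \<phi> is supported in radius \<open>R\<close> and its
    translates in radius \<open>R + 1\<close>, where \<open>G\<close> bounds \<open>g\<close>; the
    quotients of \<phi> are bounded by \<open>C\<close> through the mean value theorem.\<close>
  define B where "B x = (if x \<in> cball (0::real^'n) (R + 1) then G * C else 0)" for x
  have lip: "\<bar>\<phi> (x - h n *\<^sub>R ?e) - \<phi> x\<bar> \<le> h n * C" for x n
  proof -
    obtain w where "\<phi> (x + 0 *\<^sub>R ?e) - \<phi> (x + (- h n) *\<^sub>R ?e) = (0 - (- h n)) * pd i \<phi> (x + w *\<^sub>R ?e)"
      using MVT2[of "- h n" 0 "\<lambda>t. \<phi> (x + t *\<^sub>R ?e)" "\<lambda>t. pd i \<phi> (x + t *\<^sub>R ?e)"] pd_line[OF sm] h[of n]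
      by auto
    then have "\<phi> (x - h n *\<^sub>R ?e) - \<phi> x = - (h n * pd i \<phi> (x + w *\<^sub>R ?e))" by simp
    then show ?thesis using h[of n] C(1) by (simp add: abs_mult)
  qed
  have "(\<lambda>n. integral UNIV (f n)) \<longlonglongrightarrow> integral UNIV (\<lambda>x. - (g x * pd i \<phi> x))"
  proof (rule dominated_convergence(2)[where h=B])
    show "f n integrable_on UNIV" for n
    proof -
      have "(\<lambda>x. (1 / h n) * (g x * \<phi> (x - h n *\<^sub>R ?e) - g x * \<phi> x)) integrable_on UNIV"
        using io[OF i2] io[OF i3] by (intro integrable_on_mult_right integrable_diff)
      moreover have "f n = (\<lambda>x. (1 / h n) * (g x * \<phi> (x - h n *\<^sub>R ?e) - g x * \<phi> x))"
        using h[of n] by (auto simp: f_def field_simps)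
      ultimately show ?thesis by simp
    qed
    have "(\<lambda>x. G * C) integrable_on cball (0::real^'n) (R + 1)"
      by (intro integrable_on_const lmeasurable_cball)
    then show "B integrable_on UNIV"
      unfolding B_def by (subst integrable_restrict_UNIV)
    show "norm (f n x) \<le> B x" for n x
    proof (cases "x \<in> cball 0 (R + 1)")
      case True
      have "\<bar>(\<phi> (x - h n *\<^sub>R ?e) - \<phi> x) / h n\<bar> \<le> C"
        using lip[of x n] h[of n] by (simp add: field_simps)
      then have "\<bar>g x\<bar> * \<bar>(\<phi> (x - h n *\<^sub>R ?e) - \<phi> x) / h n\<bar> \<le> G * C"
        using G True by (intro mult_mono) auto
      then show ?thesis
        using True by (simp only: f_def B_def real_norm_def abs_mult if_True)
    next
      case False
      then have "f n x = 0" using z z'[of x n] by (auto simp: f_def)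
      then show ?thesis using False by (simp add: B_def)
    qed
    show "(\<lambda>n. f n x) \<longlonglongrightarrow> - (g x * pd i \<phi> x)" for x
    proof -
      \<comment> \<open>The shift on \<phi> goes backwards, by \<open>- h n\<close>; this is where
        the minus sign of the limit comes from.\<close>
      have "((\<lambda>t. (\<phi> (x + t *\<^sub>R ?e) - \<phi> x) / t) \<longlongrightarrow> pd i \<phi> x) (at 0)"
        using pd_line[OF sm, of x i 0] by (simp add: DERIV_def)
      moreover have "filterlim (\<lambda>n. - h n) (at 0) sequentially"
        unfolding filterlim_at h_def
        using tendsto_minus[OF LIMSEQ_inverse_real_of_nat]
        by (auto simp: inverse_eq_divide)
      ultimately have "(\<lambda>n. (\<phi> (x + (- h n) *\<^sub>R ?e) - \<phi> x) / (- h n)) \<longlonglongrightarrow> pd i \<phi> x"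
        by (rule filterlim_compose)
      then have "(\<lambda>n. - g x * ((\<phi> (x + (- h n) *\<^sub>R ?e) - \<phi> x) / (- h n))) \<longlonglongrightarrow> - g x * pd i \<phi> x"
        by (intro tendsto_mult tendsto_const)
      then show ?thesis by (simp add: f_def)
    qed
  qed
  then show ?thesis unfolding eq by simp
qed

text \<open>The constant function 1 has vanishing difference quotients, so the limit of its pairing
  is 0.\<close>

lemma integral_pd_eq_0:
  fixes \<phi> :: "real^'n::finite \<Rightarrow> real"
  assumes "test_fun UNIV \<phi>" shows "integral UNIV (pd i \<phi>) = 0"
  using difference_quotient_pairing[OF _ assms, of "\<lambda>_. 1" i]
  by (simp add: LIMSEQ_const_iff)

text \<open>Minus the derivative of the profile of \<open>bump 1\<close>, that is z^2 exp(-z) with z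
  = 1/(1-s). It is left unnormalised; later statements subtract the centre value inside the integral
  instead.\<close>

definition mean_kernel :: "real^'n \<Rightarrow> real \<Rightarrow> real^'n::finite \<Rightarrow> real" where
  "mean_kernel a t x = - bump (flat_deriv 1) a t x"

definition laplacian :: "(real^'n::finite \<Rightarrow> real) \<Rightarrow> real^'n \<Rightarrow> real" where
  "laplacian f x = (\<Sum>i\<in>UNIV. pd i (pd i f) x)"

lemma mean_kernel_nonneg: "mean_kernel a t x \<ge> 0"
  by (auto simp: mean_kernel_def bump_def flat_def flat_deriv_def poly_monom)

lemma mean_kernel_pos: assumes "x \<in> ball a t" shows "mean_kernel a t x > 0"
proof -
  define s where "s = (x - a) \<bullet> (x - a) / t\<^sup>2"
  have "s < 1" using inner_div_less_1[OF assms] by (simp add: s_def)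
  then have "(1 / (1 - s))\<^sup>2 > 0" by (intro zero_less_power) auto
  then have "- flat (flat_deriv 1) s > 0"
    using \<open>s < 1\<close> by (simp add: flat_def flat_deriv_def poly_monom)
  then show ?thesis by (simp add: mean_kernel_def bump_def s_def)
qed

lemma mean_kernel_eq_0: "x \<notin> ball a t \<Longrightarrow> t > 0 \<Longrightarrow> mean_kernel a t x = 0"
  by (simp add: mean_kernel_def bump_eq_0)

lemma continuous_on_mean_kernel: "t \<noteq> 0 \<Longrightarrow> continuous_on S (mean_kernel a t)"
  unfolding mean_kernel_def[abs_def] by (intro continuous_intros continuous_on_bump)

text \<open>The profile depends on s alone and vanishes for s > 1, so compactness of [0,1] gives one
  bound for all centres and radii.\<close>

lemma mean_kernel_bounded: obtains C where "C \<ge> 0" "\<And>a t x. mean_kernel a t x \<le> C"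
proof -
  have "bounded (flat (flat_deriv 1) ` {0..1})"
    by (intro compact_imp_bounded compact_continuous_image continuous_intros compact_Icc)
  then obtain C where C: "C > 0" "\<And>s. s \<in> {0..1} \<Longrightarrow> \<bar>flat (flat_deriv 1) s\<bar> \<le> C"
    by (auto simp: bounded_pos)
  have "- flat (flat_deriv 1) s \<le> C" if "s \<ge> 0" for s
    using that C(1) C(2)[of s] by (cases "s \<le> 1") (auto simp: flat_def)
  then have "mean_kernel a t x \<le> C" for a x :: "real^'n" and t
    by (auto simp: mean_kernel_def bump_def)
  then show thesis using that[of C] C(1) by auto
qed

text \<open>Both sides equal t^(-N-1) (N F' + 2 s F''): the first term comes from the factor t^(-N),
  the second from the chain rule with ds/dt = -2 s / t. The power -N is the one that makes the
  result a Laplacian.\<close>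

lemma mean_kernel_scaled_deriv:
  fixes a x :: "real^'n::finite"
  assumes "t > 0"
  shows "((\<lambda>t. (1 / t) ^ CARD('n) * mean_kernel a t x) has_field_derivative
     (1 / t) ^ Suc CARD('n) * t\<^sup>2 / 2 * laplacian (bump 1 a t) x) (at t)"
proof -
  let ?N = "CARD('n)" and ?q = "flat_deriv 1" and ?r = "(x - a) \<bullet> (x - a)"
  have d: "((\<lambda>t. ?r / t\<^sup>2) has_field_derivative - 2 * ?r / t ^ 3) (at t)"
    using assms by (auto intro!: derivative_eq_intros simp: field_simps power2_eq_square power3_eq_cube)
  have "((\<lambda>t. mean_kernel a t x) has_field_derivative
      - (flat (flat_deriv ?q) (?r / t\<^sup>2) * (- 2 * ?r / t ^ 3))) (at t)"
    unfolding mean_kernel_def bump_def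
    by (intro DERIV_minus DERIV_chain2[OF flat_has_field_derivative d])
  moreover have "((\<lambda>t. (1 / t) ^ ?N) has_field_derivative (- real ?N * (1 / t) ^ Suc ?N)) (at t)"
  proof -
    \<comment> \<open>N is at least 1, so the exponent \<open>?N - 1\<close> produced by the power
      rule can be raised again.\<close>
    have "(1/t) ^ ?N = (1 / t) * (1/t) ^ (?N - 1)" 
      by (metis One_nat_def Suc_pred' power_Suc zero_less_card_finite)
    then show ?thesis
      using assms by (auto intro!: derivative_eq_intros simp: field_simps power2_eq_square)
  qed
  ultimately
  have *: "((\<lambda>t. (1 / t) ^ ?N * mean_kernel a t x) has_field_derivative
     (- real ?N * (1 / t) ^ Suc ?N) * mean_kernel a t x +
     (- (flat (flat_deriv ?q) (?r / t\<^sup>2) * (- 2 * ?r / t ^ 3))) * (1 / t) ^ ?N) (at t)"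
    using DERIV_mult by blast
  have "(- (flat (flat_deriv ?q) (?r / t\<^sup>2) * (- 2 * ?r / t ^ 3))) * (1 / t) ^ ?N
    = (1 / t) ^ Suc ?N * (2 * (?r / t\<^sup>2) * flat (flat_deriv ?q) (?r / t\<^sup>2))"
    using assms by (simp add: field_simps power2_eq_square power3_eq_cube)
  with * show ?thesis
    unfolding laplacian_def laplacian_bump[OF less_imp_neq[OF assms, symmetric]]
    using assms by (elim DERIV_cong) (simp add: bump_def mean_kernel_def algebra_simps)
qed

lemma laplacian_outside: assumes "t > 0" "x \<notin> ball a t" shows "laplacian (bump p a t) x = 0"
  using assms by (auto simp: laplacian_def laplacian_bump bump_eq_0)

lemma continuous_on_laplacian: 
  fixes f :: "real^'n::finite \<Rightarrow> real" assumes "smooth f" shows "continuous_on S (laplacian f)"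
  unfolding laplacian_def[abs_def] by (intro continuous_intros smooth_D smooth_pd assms)

text \<open>Constants pair to zero with the Laplacian of a bump, so the weak inequality for
  \<open>V\<close> carries over to \<open>V - V a\<close>.\<close>

lemma integral_laplacian_bump: 
  fixes a :: "real^'n::finite"
  assumes "t > 0" shows "integral UNIV (laplacian (bump p a t)) = 0"
proof -
  have t: "test_fun UNIV (pd i (pd i (bump p a t)))" and t': "test_fun UNIV (pd i (bump p a t))" for i
    using assms by (auto intro!: test_fun_pd test_fun_bump)
  have "(pd i (pd i (bump p a t))) integrable_on UNIV" for i
    using t[of i] by (intro set_lebesgue_integral_eq_integral(1) 
      compact_support_absolutely_integrable[where S="csupport (pd i (pd i (bump p a t)))"])
      (auto simp: test_fun_def not_csupport compact_imp_bounded smooth_D)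
  then show ?thesis
    unfolding laplacian_def[abs_def] by (subst integral_sum) (auto simp: integral_pd_eq_0[OF t'])
qed

subsection \<open>Mean value inequality and maximum principles\<close>

lemma kernel_integrable:
  assumes "continuous_on UNIV h" "t > 0"
  shows "(\<lambda>x. (h x - c) * mean_kernel a t x) absolutely_integrable_on UNIV"
proof (rule compact_support_absolutely_integrable[where S="ball a t"])
  show "continuous_on UNIV (\<lambda>x. (h x - c) * mean_kernel a t x)"
    using assms by (intro continuous_intros continuous_on_mean_kernel) auto
qed (use assms in \<open>auto simp: mean_kernel_eq_0\<close>)

lemmas kernel_integrable_on = kernel_integrable[THEN set_lebesgue_integral_eq_integral(1)]

text \<open>The scaled kernel is at most C t^(-N) and lives in a cube of volume (2t)^N, so its mass
  is at most 2^N C for every \<open>t\<close>. This uniformity, without the exact mass, is enough to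
  send the means of \<open>V - V a\<close> to 0 as the ball shrinks.\<close>

lemma scaled_kernel_mean_bound:
  fixes a :: "real^'n::finite"
  obtains C where "C \<ge> 0"
    and "\<And>W t e. continuous_on UNIV W \<Longrightarrow> t > 0 \<Longrightarrow> e \<ge> 0 \<Longrightarrow> (\<And>x. x \<in> ball a t \<Longrightarrow> \<bar>W x\<bar> \<le> e) \<Longrightarrow>
      \<bar>integral UNIV (\<lambda>x. W x * ((1 / t) ^ CARD('n) * mean_kernel a t x))\<bar> \<le> C * e"
proof -
  obtain C where C: "C \<ge> 0" "\<And>a::real^'n. \<And>t x. mean_kernel a t x \<le> C"
    using mean_kernel_bounded by blast
  let ?N = "CARD('n)"
  have "\<bar>integral UNIV (\<lambda>x. W x * ((1 / t) ^ ?N * mean_kernel a t x))\<bar> \<le> (2 ^ ?N * C) * e"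
    if W: "continuous_on UNIV W" and t: "t > 0" and e: "e \<ge> 0" and We: "\<And>x. x \<in> ball a t \<Longrightarrow> \<bar>W x\<bar> \<le> e"
    for W :: "real^'n \<Rightarrow> real" and t e :: real
  proof -
    let ?f = "\<lambda>x. W x * ((1 / t) ^ ?N * mean_kernel a t x)"
    let ?B = "cbox (a - (\<chi> i. t)) (a + (\<chi> i. t))"
    have sub: "ball a t \<subseteq> ?B"
    proof
      fix x assume "x \<in> ball a t"
      then have "\<bar>(x - a) $ i\<bar> \<le> t" for i
        using component_le_norm_cart[of "x - a" i] by (simp add: dist_norm norm_minus_commute)
      then have "a $ i - t \<le> x $ i \<and> x $ i \<le> a $ i + t" for i
        by (simp add: abs_le_iff) (metis add.commute diff_le_eq le_diff_eq minus_diff_eq)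
      then show "x \<in> ?B" by (auto simp: mem_box_cart)
    qed
    have UB: "integral UNIV ?f = integral ?B ?f"
    proof -
      have "(\<lambda>x. if x \<in> ?B then ?f x else 0) = ?f"
        using sub mean_kernel_eq_0[of _ a t] t by (force simp: fun_eq_iff)
      then show ?thesis using integral_restrict_UNIV[of ?B ?f] by simp
    qed
    have B: "norm (integral ?B ?f) \<le> (e * ((1 / t) ^ ?N * C)) * measure lborel ?B"
    proof (rule has_integral_bound)
      show "0 \<le> e * ((1 / t) ^ ?N * C)" using e t C by simp
      have "?f integrable_on ?B"
        using W t by (intro integrable_continuous continuous_intros continuous_on_mean_kernel) (auto intro: continuous_on_subset)
      then show "(?f has_integral integral ?B ?f) ?B" by (rule integrable_integral)
      show "norm (?f x) \<le> e * ((1 / t) ^ ?N * C)" for x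
      proof (cases "x \<in> ball a t")
        case True
        then have "\<bar>W x\<bar> * ((1 / t) ^ ?N * mean_kernel a t x) \<le> e * ((1 / t) ^ ?N * C)"
          using We e t C by (intro mult_mono) (auto intro!: mult_left_mono mean_kernel_nonneg mult_nonneg_nonneg)
        then show ?thesis using t by (simp add: abs_mult mean_kernel_nonneg)
      next
        case False
        then show ?thesis using e t C by (simp add: mean_kernel_eq_0)
      qed
    qed
    have mB: "measure lborel ?B = (2 * t) ^ ?N"
    proof -
      have "a \<in> ?B" using sub t by auto
      then have "?B \<noteq> {}" by blast
      then show ?thesis by (simp add: content_cbox_cart)
    qed
    have p2: "(1 / t) ^ ?N * (2 * t) ^ ?N = 2 ^ ?N"
    proof -
      have "(1 / t) * (2 * t) = 2" using t by simp
      then show ?thesis by (metis power_mult_distrib)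
    qed
    have "e * ((1 / t) ^ ?N * C) * (2 * t) ^ ?N = ((1 / t) ^ ?N * (2 * t) ^ ?N) * C * e"
      by (simp only: mult_ac)
    then show ?thesis using B unfolding UB mB p2 real_norm_def by (rule ord_le_eq_trans[rotated])
  qed
  then show thesis using that[of "2 ^ ?N * C"] C by simp
qed

text \<open>The derivative in \<open>t\<close> of the scaled kernel is a nonnegative multiple of the Laplacian of a bump,
  so the kernel means of a weakly superharmonic function decrease in \<open>t\<close> from the centre value.\<close>

lemma weakly_superharmonic_mean:
  fixes V :: "real^'n::finite \<Rightarrow> real"
  assumes V: "continuous_on UNIV V"
    and lap: "\<And>t. 0 < t \<Longrightarrow> t < r \<Longrightarrow> integral UNIV (\<lambda>x. V x * laplacian (bump 1 a t) x) \<le> 0"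
    and t: "0 < t" "t < r"
  shows "integral UNIV (\<lambda>x. (V x - V a) * mean_kernel a t x) \<le> 0"
proof -
  let ?N = "CARD('n)"
  define W where "W x = V x - V a" for x
  have cW: "continuous_on S W" for S
    unfolding W_def using V by (auto intro!: continuous_intros intro: continuous_on_subset)
  define k where "k t x = (1 / t) ^ ?N * mean_kernel a t x" for t x
  define k' where "k' t x = (1 / t) ^ Suc ?N * t\<^sup>2 / 2 * laplacian (bump 1 a t) x" for t x
  define J where "J t = integral UNIV (\<lambda>x. W x * k t x)" for t
  \<comment> \<open>One box for all radii below \<open>r\<close>: differentiation under the integral
    needs a domain independent of the radius.\<close>
  obtain b c where bc: "ball a r \<subseteq> cbox b c"
    using bounded_subset_cbox_symmetric[OF bounded_ball] by metis
  have outside: "k s x = 0" "k' s x = 0" if "0 < s" "s < r" "x \<notin> cbox b c" for s x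
  proof -
    have "x \<notin> ball a s" using that bc by (force simp: subset_eq)
    then show "k s x = 0" "k' s x = 0"
      using that by (auto simp: k_def k'_def mean_kernel_eq_0 laplacian_outside)
  qed
  have JB: "J s = integral (cbox b c) (\<lambda>x. W x * k s x)"
    and JB': "integral UNIV (\<lambda>x. W x * k' s x) = integral (cbox b c) (\<lambda>x. W x * k' s x)" if "0 < s" "s < r" for s
  proof -
    have e1: "(\<lambda>x. W x * k s x) = (\<lambda>x. if x \<in> cbox b c then W x * k s x else 0)"
      and e2: "(\<lambda>x. W x * k' s x) = (\<lambda>x. if x \<in> cbox b c then W x * k' s x else 0)"
      using outside[OF that] by auto
    show "J s = integral (cbox b c) (\<lambda>x. W x * k s x)"
      unfolding J_def by (subst e1) (rule integral_restrict_UNIV)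
    show "integral UNIV (\<lambda>x. W x * k' s x) = integral (cbox b c) (\<lambda>x. W x * k' s x)"
      by (subst e2) (rule integral_restrict_UNIV)
  qed
  have neg: "integral UNIV (\<lambda>x. W x * k' s x) \<le> 0" if s: "0 < s" "s < r" for s
  proof -
    let ?l = "laplacian (bump 1 a s)"
    have i: "(\<lambda>x. h x * ?l x) integrable_on UNIV" if "continuous_on UNIV h" for h
      using that s by (intro set_lebesgue_integral_eq_integral(1) compact_support_absolutely_integrable[where S="ball a s"])
        (auto simp: laplacian_outside intro!: continuous_intros continuous_on_laplacian smooth_bump)
    have "integral UNIV (\<lambda>x. W x * ?l x) = integral UNIV (\<lambda>x. V x * ?l x - V a * ?l x)"
      by (simp add: W_def algebra_simps)
    also have "\<dots> = integral UNIV (\<lambda>x. V x * ?l x) - V a * integral UNIV ?l"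
      using i[OF V] i[of "\<lambda>_. V a"] by (subst integral_diff) auto
    also have "\<dots> \<le> 0" using lap[OF s] integral_laplacian_bump[OF s(1), of 1 a] by simp
    finally have "integral UNIV (\<lambda>x. W x * ?l x) \<le> 0" .
    moreover have "(\<lambda>x. W x * k' s x) = (\<lambda>x. ((1 / s) ^ Suc ?N * s\<^sup>2 / 2) * (W x * ?l x))"
      by (simp add: k'_def mult_ac)
    moreover have "0 \<le> (1 / s) ^ Suc ?N * s\<^sup>2 / 2" using s by simp
    ultimately show ?thesis
      by (simp only: integral_mult_right mult_nonneg_nonpos)
  qed
  have deriv: "(J has_field_derivative integral UNIV (\<lambda>x. W x * k' s x)) (at s)" if s: "0 < s" "s < r" for s
  proof -
    have "((\<lambda>s. integral (cbox b c) (\<lambda>x. W x * k s x)) has_field_derivative integral (cbox b c) (\<lambda>x. W x * k' s x))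
       (at s within {0<..<r})"
    proof (rule leibniz_rule_field_derivative)
      fix u x assume "u \<in> {0<..<r}" 
      then have "((\<lambda>s. k s x) has_field_derivative k' u x) (at u)"
        unfolding k_def k'_def using mean_kernel_scaled_deriv[of u a x] by auto
      then show "((\<lambda>s. W x * k s x) has_field_derivative W x * k' u x) (at u within {0<..<r})"
        by (intro DERIV_cmult) (rule has_field_derivative_at_within)
    next
      fix u assume "u \<in> {0<..<r}"
      then show "(\<lambda>x. W x * k u x) integrable_on cbox b c" unfolding k_def
        by (intro integrable_continuous continuous_intros continuous_on_mean_kernel cW) auto
    next
      \<comment> \<open>Expressed through the profiles, the integrand is visibly continuous jointly
        in radius and point.\<close>
      have e: "laplacian (bump 1 a u) x = (2 / u\<^sup>2) *
        (real ?N * flat (flat_deriv 1) ((x - a) \<bullet> (x - a) / u\<^sup>2)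
         + 2 * ((x - a) \<bullet> (x - a) / u\<^sup>2) * flat (flat_deriv (flat_deriv 1)) ((x - a) \<bullet> (x - a) / u\<^sup>2))"
        if "u \<in> {0<..<r}" for u x
        using that by (auto simp: laplacian_def laplacian_bump bump_def)
      have "continuous_on ({0<..<r} \<times> cbox b c) (\<lambda>(u,x). W x * ((1 / u) ^ Suc ?N * u\<^sup>2 / 2 * ((2 / u\<^sup>2) *
        (real ?N * flat (flat_deriv 1) ((x - a) \<bullet> (x - a) / u\<^sup>2)
         + 2 * ((x - a) \<bullet> (x - a) / u\<^sup>2) * flat (flat_deriv (flat_deriv 1)) ((x - a) \<bullet> (x - a) / u\<^sup>2)))))"
        unfolding split_beta
        by (intro continuous_intros continuous_on_compose2[OF cW[of UNIV]]) auto
      then show "continuous_on ({0<..<r} \<times> cbox b c) (\<lambda>(u,x). W x * k' u x)"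
        by (rule continuous_on_eq) (auto simp: k'_def e)
    qed (use s in auto)
    moreover have at: "at s within {0<..<r} = at s" by (rule at_within_open) (use s in auto)
    ultimately have "((\<lambda>s. integral (cbox b c) (\<lambda>x. W x * k s x)) has_field_derivative integral UNIV (\<lambda>x. W x * k' s x)) (at s)"
      by (simp only: at JB'[OF s])
    then show ?thesis
      by (rule has_field_derivative_transform_within_open[where S="{0<..<r}"]) (use s JB in auto)
  qed
  obtain C where C: "C \<ge> 0"
    "\<And>W t e. continuous_on UNIV W \<Longrightarrow> t > 0 \<Longrightarrow> e \<ge> 0 \<Longrightarrow> (\<And>x. x \<in> ball a t \<Longrightarrow> \<bar>W x\<bar> \<le> e) \<Longrightarrow>
      \<bar>integral UNIV (\<lambda>x. W x * ((1 / t) ^ CARD('n) * mean_kernel a t x))\<bar> \<le> C * e"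
    using scaled_kernel_mean_bound[of a] by blast
  have "J t \<le> 0 + e" if e: "e > 0" for e
  proof -
    \<comment> \<open>Dividing by \<open>C + 1\<close> rather than \<open>C\<close> covers the case
      \<open>C = 0\<close>.\<close>
    have "e / (C + 1) > 0" using e C(1) by simp
    moreover have "continuous (at a) V" using V by (simp add: continuous_on_eq_continuous_at)
    ultimately obtain s where s: "s > 0" "\<And>x. dist x a < s \<Longrightarrow> \<bar>V x - V a\<bar> < e / (C + 1)"
      unfolding continuous_at_eps_delta dist_real_def by (metis dist_commute)
    \<comment> \<open>Below both \<open>t\<close> and the continuity radius: \<open>J\<close> is at
      most \<open>e\<close> at \<open>s0\<close> and does not increase from \<open>s0\<close> to
      \<open>t\<close>.\<close>
    define s0 where "s0 = min s t / 2"
    have s0: "0 < s0" "s0 < t" "s0 < s" using s t by (auto simp: s0_def min_def)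
    have "\<bar>J s0\<bar> \<le> C * (e / (C + 1))"
      unfolding J_def k_def using s0 s(2) e C(1) cW
      by (intro C(2)) (auto simp: W_def dist_commute intro!: less_imp_le)
    also have "\<dots> \<le> e" using C(1) e by (simp add: field_simps)
    finally have "J s0 \<le> e" by simp
    moreover have "J t \<le> J s0"
      by (rule DERIV_nonpos_imp_nonincreasing[where f=J]) (use s0 t deriv neg in \<open>meson less_imp_le less_le_trans le_less_trans\<close>)+
    ultimately show ?thesis by simp
  qed
  then have "J t \<le> 0" by (rule field_le_epsilon)
  moreover have "J t = (1 / t) ^ ?N * integral UNIV (\<lambda>x. W x * mean_kernel a t x)"
  proof -
    have "(\<lambda>x. W x * k t x) = (\<lambda>x. (1 / t) ^ ?N * (W x * mean_kernel a t x))" by (simp add: k_def mult_ac)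
    then show ?thesis by (simp add: J_def)
  qed
  moreover have "0 < (1 / t) ^ ?N" using t by simp
  ultimately have "integral UNIV (\<lambda>x. W x * mean_kernel a t x) \<le> 0"
    by (metis mult_le_0_iff not_less)
  then show ?thesis by (simp only: W_def)
qed

text \<open>With the centre value inside the integral the mass of the kernel never appears. The
  radius may depend on the point, since the maximum principles use the inequality only
  locally.\<close>

definition submean :: "(real^'n::finite \<Rightarrow> real) \<Rightarrow> real^'n \<Rightarrow> bool" where
  "submean h a \<longleftrightarrow> (\<exists>r>0. \<forall>t. 0 < t \<longrightarrow> t < r \<longrightarrow> 0 \<le> integral UNIV (\<lambda>x. (h x - h a) * mean_kernel a t x))"

text \<open>At a maximum the integrand is nonpositive while its integral is nonnegative, so it
  vanishes; strict positivity of the kernel on the ball then forces equality.\<close>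

lemma submean_local_max:
  fixes h :: "real^'n::finite \<Rightarrow> real"
  assumes h: "continuous_on UNIV h" and sub: "submean h a" and \<Omega>: "open \<Omega>" "a \<in> \<Omega>"
    and max: "\<And>x. x \<in> \<Omega> \<Longrightarrow> h x \<le> h a"
  obtains r where "r > 0" "ball a r \<subseteq> \<Omega>" "\<And>x. x \<in> ball a r \<Longrightarrow> h x = h a"
proof -
  obtain r where r: "r > 0" "\<And>t. 0 < t \<Longrightarrow> t < r \<Longrightarrow> 0 \<le> integral UNIV (\<lambda>x. (h x - h a) * mean_kernel a t x)"
    using sub by (auto simp: submean_def)
  obtain s where s: "s > 0" "ball a s \<subseteq> \<Omega>" using \<Omega> openE by blast
  define t where "t = min r s / 2"
  have t: "0 < t" "t < r" "t < s" using r s by (auto simp: t_def min_def)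
  define f where "f x = - ((h x - h a) * mean_kernel a t x)" for x
  have fn: "f x \<ge> 0" for x
  proof (cases "x \<in> ball a t")
    case True
    then have "x \<in> \<Omega>" using s(2) t by (auto simp: subset_eq)
    then have "h x \<le> h a" by (rule max)
    then show ?thesis by (simp add: f_def mult_nonpos_nonneg mean_kernel_nonneg)
  qed (use t in \<open>simp add: f_def mean_kernel_eq_0\<close>)
  have cf: "continuous_on S f" for S
    unfolding f_def using h t by (intro continuous_intros continuous_on_mean_kernel) (auto intro: continuous_on_subset)
  have "h x = h a" if x: "x \<in> ball a t" for x
  proof -
    obtain b c where bc: "ball a t \<subseteq> cbox b c"
      using bounded_subset_cbox_symmetric[OF bounded_ball] by metis
    have xb: "x \<in> box b c"
      using bc x by (metis interior_cbox interior_maximal open_ball subsetD)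
    have "f integrable_on UNIV"
      unfolding f_def using kernel_integrable_on[OF h t(1)] by (intro integrable_neg)
    moreover have "f integrable_on cbox b c" by (intro integrable_continuous cf)
    ultimately have "integral (cbox b c) f \<le> integral UNIV f"
      using fn by (intro integral_subset_le) auto
    also have "\<dots> = - integral UNIV (\<lambda>x. (h x - h a) * mean_kernel a t x)"
      unfolding f_def[abs_def] by (rule integral_neg)
    also have "\<dots> \<le> 0" using r(2)[OF t(1,2)] by simp
    finally have "integral (cbox b c) f \<le> 0" .
    moreover have "0 \<le> integral (cbox b c) f"
      by (rule integral_nonneg[OF \<open>f integrable_on cbox b c\<close> fn])
    ultimately have i0: "integral (cbox b c) f = 0" by (rule order_antisym)
    have "box b c \<noteq> {}" using xb by blast
    then have "(integral (cbox b c) f = 0) = (\<forall>x\<in>cbox b c. f x = 0)"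
      by (intro integral_cbox_eq_0_iff cf fn)
    with i0 have "\<forall>x\<in>cbox b c. f x = 0" by (simp only:)
    then have "f x = 0" using xb box_subset_cbox[of b c] by blast
    then have "(h x - h a) * mean_kernel a t x = 0" by (simp only: f_def neg_equal_0_iff_equal)
    moreover have "mean_kernel a t x \<noteq> 0" using mean_kernel_pos[OF x] by (rule less_imp_neq[symmetric])
    ultimately show ?thesis by (simp only: mult_eq_0_iff simp_thms right_minus_eq)
  qed
  moreover have "ball a t \<subseteq> \<Omega>" using s(2) t subset_ball[of t s a] by (meson less_imp_le subset_trans)
  ultimately show thesis using that t(1) by blast
qed

text \<open>Among the maximum points choose one with largest \<open>i\<close>-th coordinate. Were it
  interior, \<open>h\<close> would be constant on a ball around it, and a step along axis
  \<open>i\<close> would reach a maximum point further out. This treats all components of \<Omega>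
  at once.\<close>

lemma submean_weak_maximum:
  fixes h :: "real^'n::finite \<Rightarrow> real"
  assumes h: "continuous_on UNIV h" and \<Omega>: "open \<Omega>" "bounded \<Omega>"
    and sub: "\<And>a. a \<in> \<Omega> \<Longrightarrow> submean h a" and le: "\<And>x. x \<in> frontier \<Omega> \<Longrightarrow> h x \<le> m"
    and x: "x \<in> \<Omega>"
  shows "h x \<le> m"
proof (rule ccontr)
  assume "\<not> h x \<le> m"
  have "compact (closure \<Omega>)" using \<Omega> by (simp add: compact_closure)
  moreover have "closure \<Omega> \<noteq> {}" using x by auto
  moreover have ch: "continuous_on (closure \<Omega>) h" using h by (auto intro: continuous_on_subset)
  ultimately obtain b where b: "b \<in> closure \<Omega>" "\<And>y. y \<in> closure \<Omega> \<Longrightarrow> h y \<le> h b"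
    using continuous_attains_sup by metis
  define S where "S = closure \<Omega> \<inter> h -` {h b}"
  have "closed S" unfolding S_def using ch by (intro continuous_closed_preimage) auto
  moreover have "bounded S" using \<Omega> by (auto simp: S_def bounded_closure)
  ultimately have "compact S" by (simp add: compact_eq_bounded_closed)
  moreover have "S \<noteq> {}" using b by (auto simp: S_def)
  \<comment> \<open>Index types are nonempty, so a coordinate direction exists; any one will
    do.\<close>
  moreover obtain i :: 'n where True by blast
  ultimately obtain a where a: "a \<in> S" "\<And>y. y \<in> S \<Longrightarrow> y $ i \<le> a $ i"
    using continuous_attains_sup[of S "\<lambda>y. y $ i"] continuous_on_component[OF continuous_on_id] by metis
  have "h b > m" using b(2)[of x] x \<open>\<not> h x \<le> m\<close> closure_subset by fastforce
  then have "a \<notin> frontier \<Omega>" using a le[of a] by (auto simp: S_def)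
  then have a\<Omega>: "a \<in> \<Omega>" using a \<Omega>(1) by (auto simp: S_def frontier_def interior_open)
  have ab: "h a = h b" using a by (auto simp: S_def)
  obtain r where r: "r > 0" "ball a r \<subseteq> \<Omega>" "\<And>x. x \<in> ball a r \<Longrightarrow> h x = h a"
    using submean_local_max[OF h sub[OF a\<Omega>] \<Omega>(1) a\<Omega>] b(2) ab closure_subset by (metis subsetD)
  define y where "y = a + (r / 2) *\<^sub>R axis i 1"
  have "y \<in> ball a r" using r(1) by (auto simp: y_def dist_norm)
  then have "y \<in> \<Omega>" "h y = h b" using r(2) r(3)[of y] ab by auto
  then have "y \<in> S" using closure_subset[of \<Omega>] by (auto simp: S_def)
  then show False using a(2)[of y] r(1) by (simp add: y_def)
qed

text \<open>The set where the maximum is attained is relatively closed by continuity and open by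
  \<open>submean_local_max\<close>, hence all of the connected \<Omega>.\<close>

lemma submean_strong_maximum:
  fixes h :: "real^'n::finite \<Rightarrow> real"
  assumes h: "continuous_on UNIV h" and \<Omega>: "open \<Omega>" "connected \<Omega>"
    and sub: "\<And>a. a \<in> \<Omega> \<Longrightarrow> submean h a" and le: "\<And>x. x \<in> \<Omega> \<Longrightarrow> h x \<le> h a"
    and a: "a \<in> \<Omega>" and x: "x \<in> \<Omega>"
  shows "h x = h a"
proof -
  define S where "S = {x \<in> \<Omega>. h x = h a}"
  have "open S"
  proof (rule openI)
    fix b assume "b \<in> S"
    then have b: "b \<in> \<Omega>" "h b = h a" by (auto simp: S_def)
    obtain r where "r > 0" "ball b r \<subseteq> \<Omega>" "\<And>x. x \<in> ball b r \<Longrightarrow> h x = h b"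
      using submean_local_max[OF h sub[OF b(1)] \<Omega>(1) b(1)] le b by metis
    then show "\<exists>e>0. ball b e \<subseteq> S" using b by (intro exI[of _ r]) (auto simp: S_def)
  qed
  moreover have "openin (top_of_set \<Omega>) S \<and> closedin (top_of_set \<Omega>) S"
  proof
    show "openin (top_of_set \<Omega>) S" using \<open>open S\<close> by (auto simp: S_def intro: open_subset)
    have "S = \<Omega> \<inter> h -` {h a}" by (auto simp: S_def)
    then show "closedin (top_of_set \<Omega>) S"
      using continuous_closedin_preimage[of \<Omega> h "{h a}"] h by (auto intro: continuous_on_subset)
  qed
  ultimately have "S = \<Omega>" using \<Omega>(2) a by (auto simp: connected_clopen S_def)
  then show ?thesis using x by (auto simp: S_def)
qed

subsection \<open>Orthogonal invariance, cutoffs and null boundaries\<close>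

text \<open>The change-of-variables theorem for linear maps is only available for well-ordered index types;
  an arbitrary finite index type is transferred to the following well-ordered copy.\<close>

typedef 'a wcopy = "UNIV :: 'a set" by simp

instance wcopy :: (finite) finite
proof
  have "(UNIV :: 'a wcopy set) = range Abs_wcopy"
    by (metis Rep_wcopy_inverse surjI)
  then show "finite (UNIV :: 'a wcopy set)" by (metis finite finite_imageI)
qed

instantiation wcopy :: (finite) wellorder
begin

definition wcopy_rank :: "'a wcopy \<Rightarrow> nat" where
  "wcopy_rank x = to_nat_on UNIV (Rep_wcopy x)"

definition less_eq_wcopy :: "'a wcopy \<Rightarrow> 'a wcopy \<Rightarrow> bool" where
  "x \<le> y \<longleftrightarrow> wcopy_rank x \<le> wcopy_rank y"

definition less_wcopy :: "'a wcopy \<Rightarrow> 'a wcopy \<Rightarrow> bool" where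
  "x < y \<longleftrightarrow> wcopy_rank x < wcopy_rank y"

lemma wcopy_rank_inject: "wcopy_rank (x :: 'a wcopy) = wcopy_rank y \<Longrightarrow> x = y"
  using inj_on_to_nat_on[OF countable_finite[OF finite], of "UNIV :: 'a set"]
  by (simp add: wcopy_rank_def inj_on_def Rep_wcopy_inject)

instance
proof
  fix P :: "'a wcopy \<Rightarrow> bool" and a
  assume step: "\<And>x. (\<And>y. y < x \<Longrightarrow> P y) \<Longrightarrow> P x"
  show "P a" by (induction a rule: measure_induct_rule[of wcopy_rank]) (auto intro: step simp: less_wcopy_def)
qed (auto simp: less_eq_wcopy_def less_wcopy_def wcopy_rank_inject)

end

definition to_wcopy :: "real^'n::finite \<Rightarrow> real^'n wcopy" where
  "to_wcopy x = (\<chi> j. x $ Rep_wcopy j)"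

definition of_wcopy :: "real^'n wcopy \<Rightarrow> real^'n::finite" where
  "of_wcopy y = (\<chi> i. y $ Abs_wcopy i)"

lemma of_to_wcopy [simp]: "of_wcopy (to_wcopy x) = x" "to_wcopy (of_wcopy y) = y"
  by (simp_all add: of_wcopy_def to_wcopy_def vec_eq_iff Rep_wcopy_inverse Abs_wcopy_inverse)

lemma bij_Abs_wcopy: "bij (Abs_wcopy :: 'a \<Rightarrow> 'a wcopy)"
  by (rule bij_betw_byWitness[where f'=Rep_wcopy]) (auto simp: Abs_wcopy_inverse Rep_wcopy_inverse)

lemma wcopy_cbox: "of_wcopy ` cbox u v = cbox (of_wcopy u) (of_wcopy v)"
  "to_wcopy ` cbox a b = cbox (to_wcopy a) (to_wcopy b)"
proof -
  have 1: "of_wcopy x \<in> cbox (of_wcopy u) (of_wcopy v)" if "x \<in> cbox u v" for x u v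
    using that by (auto simp: mem_box_cart of_wcopy_def)
  have 2: "to_wcopy x \<in> cbox (to_wcopy u) (to_wcopy v)" if "x \<in> cbox u v" for x u v
    using that by (auto simp: mem_box_cart to_wcopy_def)
  show "of_wcopy ` cbox u v = cbox (of_wcopy u) (of_wcopy v)"
  proof (intro subset_antisym subsetI)
    fix x assume "x \<in> cbox (of_wcopy u) (of_wcopy v)"
    from 2[OF this] show "x \<in> of_wcopy ` cbox u v" by (auto intro: image_eqI[of _ _ "to_wcopy x"])
  qed (auto intro: 1)
  show "to_wcopy ` cbox a b = cbox (to_wcopy a) (to_wcopy b)"
  proof (intro subset_antisym subsetI)
    fix x assume "x \<in> cbox (to_wcopy a) (to_wcopy b)"
    from 1[OF this] show "x \<in> to_wcopy ` cbox a b" by (auto intro: image_eqI[of _ _ "of_wcopy x"])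
  qed (auto intro: 2)
qed

lemma wcopy_linear: "linear of_wcopy" "linear to_wcopy"
  by (auto intro!: linearI simp: of_wcopy_def to_wcopy_def vec_eq_iff)

lemma wcopy_norm: "norm (of_wcopy y) = norm y"
proof -
  have "(\<Sum>i\<in>UNIV. (y $ Abs_wcopy i)\<^sup>2) = (\<Sum>j\<in>UNIV. (y $ j)\<^sup>2)"
    using bij_Abs_wcopy by (rule sum.reindex_bij_betw)
  then show ?thesis by (simp add: norm_vec_def L2_set_def of_wcopy_def)
qed

text \<open>Renaming coordinates sends boxes to boxes of the same volume, so the twiddle rule for
  integrals applies with factor 1.\<close>

lemma integral_of_wcopy:
  fixes f :: "real^'n::finite \<Rightarrow> real"
  assumes f: "continuous_on UNIV f" and S: "bounded S" "\<And>x. x \<notin> S \<Longrightarrow> f x = 0"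
  shows "integral UNIV (\<lambda>y. f (of_wcopy y)) = integral UNIV f"
proof -
  obtain b where b: "S \<subseteq> cbox (-b) b" using bounded_subset_cbox_symmetric[OF S(1)] by metis
  let ?B = "cbox (-b) b"
  have "f integrable_on ?B" using f by (intro integrable_continuous) (auto intro: continuous_on_subset)
  then have i: "(f has_integral integral ?B f) ?B" by (rule integrable_integral)
  have "((\<lambda>y. f (of_wcopy y)) has_integral (1 / 1) *\<^sub>R integral ?B f) (to_wcopy ` ?B)"
  proof (rule has_integral_twiddle[OF _ _ _ _ _ _ _ i])
    show "continuous (at x) of_wcopy" for x :: "real^'n wcopy"
      using linear_continuous_at[of of_wcopy] wcopy_linear(1) linear_conv_bounded_linear by blast
    show "\<exists>w z. of_wcopy ` cbox u v = cbox w z" "\<exists>w z. to_wcopy ` cbox u' v' = cbox w z" for u v :: "real^'n wcopy" and u' v' :: "real^'n"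
      using wcopy_cbox by blast+
    show "measure lborel (of_wcopy ` cbox u v) = 1 * measure lborel (cbox u v)" for u v :: "real^'n wcopy"
    proof (cases "cbox u v = {}")
      case False
      then have "of_wcopy ` cbox u v \<noteq> {}" by blast
      then have "measure lborel (of_wcopy ` cbox u v) = (\<Prod>i\<in>UNIV. v $ Abs_wcopy i - u $ Abs_wcopy i)"
        unfolding wcopy_cbox by (subst content_cbox_cart) (simp_all add: of_wcopy_def)
      also have "\<dots> = (\<Prod>j\<in>UNIV. v $ j - u $ j)"
        using bij_Abs_wcopy by (rule prod.reindex_bij_betw)
      finally show ?thesis using False by (simp add: content_cbox_cart)
    qed simp
  qed simp_all
  then have "((\<lambda>y. f (of_wcopy y)) has_integral integral ?B f) (to_wcopy ` ?B)" by simp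
  then have "((\<lambda>y. f (of_wcopy y)) has_integral integral ?B f) UNIV"
  proof (rule has_integral_on_superset)
    fix y assume "y \<notin> to_wcopy ` ?B"
    then have "of_wcopy y \<notin> ?B" by (metis image_eqI of_to_wcopy(2))
    then show "f (of_wcopy y) = 0" using b S(2) by blast
  qed simp
  moreover have "(f has_integral integral ?B f) UNIV"
    by (rule has_integral_on_superset[OF i]) (use b S(2) in auto)
  ultimately show ?thesis by (metis integral_unique)
qed

lemma integral_orthogonal_wellorder:
  fixes f :: "real^'m::{finite,wellorder} \<Rightarrow> real" and R :: "real^'m::_ \<Rightarrow> real^'m::_"
  assumes "f absolutely_integrable_on UNIV" and R: "orthogonal_transformation R"
  shows "integral UNIV (\<lambda>x. f (R x)) = integral UNIV f"
proof -
  \<comment> \<open>The linear change of variables acts on vector-valued integrands, hence the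
    wrapping into \<open>real^1\<close>.\<close>
  define F :: "real^'m::_ \<Rightarrow> real^1" where "F x = vec (f x)" for x
  have F1: "(\<lambda>x. F x $ 1) = f" by (auto simp: F_def)
  have "F absolutely_integrable_on UNIV"
    using assms(1) unfolding absolutely_integrable_on_1_iff F1 .
  moreover have "linear R" using R by (rule orthogonal_transformation_linear)
  moreover have "R ` UNIV = UNIV" using R by (rule orthogonal_transformation_surj)
  ultimately have "integral UNIV F = \<bar>det (matrix R)\<bar> *\<^sub>R integral UNIV (F \<circ> R)"
    using integral_change_of_variables_linear[where g=R and f=F and S=UNIV] by simp
  then have "integral UNIV F = integral UNIV (\<lambda>x. F (R x))"
    using R by (simp add: o_def)
  then have "vec (integral UNIV (\<lambda>x. F x $ 1)) $ (1::1) = vec (integral UNIV (\<lambda>x. F (R x) $ 1)) $ (1::1)"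
    by (simp only: integral_on_1_eq)
  then show ?thesis by (simp add: F_def)
qed

text \<open>Conjugating \<open>R\<close> by the renaming of coordinates gives an orthogonal map of
  the well-ordered copy; the integral is carried there and back.\<close>

lemma integral_orthogonal:
  fixes f :: "real^'n::finite \<Rightarrow> real" and R :: "real^'n \<Rightarrow> real^'n"
  assumes f: "continuous_on UNIV f" and S: "bounded S" "\<And>x. x \<notin> S \<Longrightarrow> f x = 0"
    and R: "orthogonal_transformation R"
  shows "integral UNIV (\<lambda>x. f (R x)) = integral UNIV f"
proof -
  let ?R = "\<lambda>y. to_wcopy (R (of_wcopy y))"
  have lin: "linear R" using R by (rule orthogonal_transformation_linear)
  have n: "norm (to_wcopy x) = norm x" for x :: "real^'n" by (metis wcopy_norm of_to_wcopy(1))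
  have R': "orthogonal_transformation ?R"
    unfolding orthogonal_transformation
    using linear_compose[OF linear_compose[OF wcopy_linear(1) lin] wcopy_linear(2)] R
    by (auto simp: o_def n wcopy_norm orthogonal_transformation)
  \<comment> \<open>A ball about the origin is preserved by \<open>R\<close>, so it also contains
    the support of the rotated function.\<close>
  obtain r where r: "S \<subseteq> cball 0 r" using bounded_subset_ballD[OF S(1), of 0] ball_subset_cball by (metis subset_trans)
  have z: "f x = 0" if "x \<notin> cball 0 r" for x using that r S(2) by blast
  have cR: "continuous_on UNIV R" using lin linear_continuous_on linear_conv_bounded_linear by blast
  have cw: "continuous_on UNIV (of_wcopy :: real^'n wcopy \<Rightarrow> _)" 
    using wcopy_linear(1) linear_continuous_on linear_conv_bounded_linear by blast
  have fR: "continuous_on UNIV (\<lambda>x. f (R x))" by (rule continuous_on_compose2[OF f cR]) auto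
  have "integral UNIV (\<lambda>x. f (R x)) = integral UNIV (\<lambda>y. f (R (of_wcopy y)))"
    by (rule integral_of_wcopy[OF fR, of "cball 0 r", symmetric])
      (use R in \<open>auto intro!: z simp: orthogonal_transformation_norm\<close>)
  also have "\<dots> = integral UNIV (\<lambda>y. f (of_wcopy (?R y)))" by simp
  also have "\<dots> = integral UNIV (\<lambda>y. f (of_wcopy y))"
  proof (rule integral_orthogonal_wellorder[OF _ R'])
    show "(\<lambda>y. f (of_wcopy y)) absolutely_integrable_on UNIV"
      by (rule compact_support_absolutely_integrable[of _ "cball 0 r"], rule continuous_on_compose2[OF f cw])
        (auto intro!: z simp: wcopy_norm)
  qed
  also have "\<dots> = integral UNIV f" by (rule integral_of_wcopy[OF f S])
  finally show ?thesis .
qed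

text \<open>The kernel sees only |x - a|, so rotating centre and point together leaves it unchanged;
  a change of variables does the rest.\<close>

lemma submean_orthogonal:
  fixes h :: "real^'n::finite \<Rightarrow> real" and R :: "real^'n \<Rightarrow> real^'n"
  assumes h: "continuous_on UNIV h" and R: "orthogonal_transformation R" and sub: "submean h (R a)"
  shows "submean (\<lambda>x. h (R x)) a"
proof -
  have k: "mean_kernel (R a) t (R x) = mean_kernel a t x" for t x
  proof -
    have "R x - R a = R (x - a)" using R by (simp add: orthogonal_transformation_linear linear_diff)
    then show ?thesis using R by (simp add: mean_kernel_def bump_def orthogonal_transformation_def)
  qed
  have "integral UNIV (\<lambda>x. (h (R x) - h (R a)) * mean_kernel a t x)
    = integral UNIV (\<lambda>x. (h x - h (R a)) * mean_kernel (R a) t x)" if "t > 0" for t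
  proof -
    have "integral UNIV (\<lambda>x. (h (R x) - h (R a)) * mean_kernel (R a) t (R x))
      = integral UNIV (\<lambda>x. (h x - h (R a)) * mean_kernel (R a) t x)"
      by (rule integral_orthogonal[where S="ball (R a) t" and f="\<lambda>x. (h x - h (R a)) * mean_kernel (R a) t x", OF _ _ _ R])
        (use that h in \<open>auto simp: mean_kernel_eq_0 intro!: continuous_intros continuous_on_mean_kernel\<close>)
    then show ?thesis by (simp add: k)
  qed
  then show ?thesis using sub by (auto simp: submean_def)
qed

lemma submean_add:
  assumes "continuous_on UNIV f" "continuous_on UNIV g" "submean f a" "submean g a"
  shows "submean (\<lambda>x. f x + g x) a"
proof -
  obtain r s where r: "r > 0" "\<And>t. 0 < t \<Longrightarrow> t < r \<Longrightarrow> 0 \<le> integral UNIV (\<lambda>x. (f x - f a) * mean_kernel a t x)"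
    and s: "s > 0" "\<And>t. 0 < t \<Longrightarrow> t < s \<Longrightarrow> 0 \<le> integral UNIV (\<lambda>x. (g x - g a) * mean_kernel a t x)"
    using assms(3,4) by (auto simp: submean_def)
  have "0 \<le> integral UNIV (\<lambda>x. (f x + g x - (f a + g a)) * mean_kernel a t x)" if "0 < t" "t < min r s" for t
  proof -
    have "(\<lambda>x. (f x + g x - (f a + g a)) * mean_kernel a t x)
      = (\<lambda>x. (f x - f a) * mean_kernel a t x + (g x - g a) * mean_kernel a t x)"
      by (simp add: algebra_simps)
    then show ?thesis using that r(2)[of t] s(2)[of t]
      by (simp add: integral_add kernel_integrable_on assms)
  qed
  then show ?thesis using r s unfolding submean_def by (intro exI[of _ "min r s"]) auto
qed

text \<open>Countably many balls with closures inside \<open>D\<close> cover \<open>D\<close>, and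
  bumps on them are combined into cutoffs tending to 1 pointwise. Their derivatives are not
  controlled.\<close>

lemma open_smooth_cutoffs:
  fixes D :: "(real^'n::finite) set"
  assumes "open D"
  obtains \<eta> :: "nat \<Rightarrow> real^'n \<Rightarrow> real" where
    "\<And>n. test_fun D (\<eta> n)" "\<And>n x. 0 \<le> \<eta> n x" "\<And>n x. \<eta> n x \<le> 1" "\<And>x. x \<in> D \<Longrightarrow> (\<lambda>n. \<eta> n x) \<longlonglongrightarrow> 1"
proof -
  define F where "F = {ball a r | a r. 0 < r \<and> cball a r \<subseteq> D}"
  have UF: "\<Union>F = D"
  proof (intro subset_antisym subsetI)
    fix x assume "x \<in> D"
    then obtain r where "r > 0" "cball x r \<subseteq> D" using assms open_contains_cball by blast
    then show "x \<in> \<Union>F" by (intro UnionI[of "ball x r"]) (auto simp: F_def)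
  next
    fix x assume "x \<in> \<Union>F"
    then obtain a r where "x \<in> ball a r" "cball a r \<subseteq> D" by (auto simp: F_def)
    then show "x \<in> D" using ball_subset_cball by blast
  qed
  obtain F' where F': "F' \<subseteq> F" "countable F'" "\<Union>F' = D"
    using Lindelof[of F] UF by (auto simp: F_def)
  show thesis
  proof (cases "F' = {}")
    case True
    then have "D = {}" using F' by simp
    moreover have "test_fun {} (\<lambda>x::real^'n. 0)"
      by (simp add: test_fun_def csupport_def smooth_const)
    ultimately show thesis using that[of "\<lambda>_ _. 0"] by simp
  next
    case False
    have "\<exists>a r. from_nat_into F' j = ball a r \<and> 0 < r \<and> cball a r \<subseteq> D" for j
      using from_nat_into[OF False] F'(1) by (fastforce simp: F_def)
    then obtain a r where ar: "\<And>j. from_nat_into F' j = ball (a j) (r j)" "\<And>j. 0 < r j" "\<And>j. cball (a j) (r j) \<subseteq> D"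
      by metis
    define b where "b j = bump 1 (a j) (r j)" for j
    have b: "0 \<le> b j x" "b j x \<le> 1" for j x
      by (auto simp: b_def bump_def flat_def)
    \<comment> \<open>\<open>n\<close> is both the number of balls and the exponent: the finite
      product keeps the support compact, and the growing power drives to 0 any factor with
      \<open>b j x > 0\<close>.\<close>
    define \<eta> where "\<eta> n x = 1 - (\<Prod>j<n. (1 - b j x) ^ n)" for n x
    have p: "0 \<le> (\<Prod>j<n. (1 - b j x) ^ n)" "(\<Prod>j<n. (1 - b j x) ^ n) \<le> 1" for n x
      using b by (auto intro!: prod_nonneg prod_le_1 power_le_one)
    have "test_fun D (\<eta> n)" for n
    proof (rule test_fun_subset)
      show "smooth (\<eta> n)"
        unfolding \<eta>_def b_def using ar(2)
        by (intro smooth_one_minus smooth_prod smooth_power smooth_bump) (simp add: less_imp_neq[symmetric])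
      let ?K = "\<Union>j<n. cball (a j) (r j)"
      show "compact ?K" by (intro compact_UN) auto
      show "?K \<subseteq> D" using ar(3) by auto
      have "\<eta> n x = 0" if "x \<notin> ?K" for x
      proof -
        have "b j x = 0" if "j < n" for j
          unfolding b_def using that \<open>x \<notin> ?K\<close> ar(2) by (intro bump_eq_0) (auto dest: less_imp_le)
        then show ?thesis by (simp add: \<eta>_def)
      qed
      then have "{x. \<eta> n x \<noteq> 0} \<subseteq> ?K" by blast
      then show "csupport (\<eta> n) \<subseteq> ?K"
        unfolding csupport_def by (rule closure_minimal) (auto intro!: compact_imp_closed \<open>compact ?K\<close>)
    qed
    moreover have "(\<lambda>n. \<eta> n x) \<longlonglongrightarrow> 1" if "x \<in> D" for x
    proof -
      obtain j where j: "x \<in> ball (a j) (r j)"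
        using \<open>x \<in> D\<close> F' ar(1) False by (metis UnionE from_nat_into_surj)
      have "b j x > 0"
        using inner_div_less_1[OF j] by (simp add: b_def bump_def flat_def)
      then have "(\<lambda>n. (1 - b j x) ^ n) \<longlonglongrightarrow> 0"
        using b[of j x] by (intro LIMSEQ_power_zero) auto
      then have "(\<lambda>n. \<Prod>j<n. (1 - b j x) ^ n) \<longlonglongrightarrow> 0"
      proof (rule tendsto_sandwich[OF _ _ tendsto_const, rotated 2])
        show "\<forall>\<^sub>F n in sequentially. 0 \<le> (\<Prod>j<n. (1 - b j x) ^ n)" using p by simp
        have "(\<Prod>i<n. (1 - b i x) ^ n) \<le> (1 - b j x) ^ n" if "j < n" for n
        proof -
          have "(\<Prod>i<n. (1 - b i x) ^ n) = (1 - b j x) ^ n * (\<Prod>i\<in>{..<n} - {j}. (1 - b i x) ^ n)"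
            using that by (intro prod.remove) auto
          also have "\<dots> \<le> (1 - b j x) ^ n * 1"
            using b by (intro mult_left_mono prod_le_1) (auto intro!: power_le_one)
          finally show ?thesis by simp
        qed
        then show "\<forall>\<^sub>F n in sequentially. (\<Prod>j<n. (1 - b j x) ^ n) \<le> (1 - b j x) ^ n"
          by (intro eventually_mono[OF eventually_gt_at_top[of j]])
      qed
      from tendsto_diff[OF tendsto_const[of 1] this] show ?thesis by (simp add: \<eta>_def)
    qed
    ultimately show thesis using that[of \<eta>] p by (simp add: \<eta>_def)
  qed
qed

text \<open>The translates by e/(j+1) are pairwise disjoint, have equal measure and all fit in one
  ball; with positive measure their total would be unbounded.\<close>

lemma negligible_disjoint_translates:
  fixes S :: "'a::euclidean_space set"
  assumes S: "S \<in> lmeasurable" "bounded S" and e: "norm e = 1"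
    and disj: "\<And>x s. x \<in> S \<Longrightarrow> x + s *\<^sub>R e \<in> S \<Longrightarrow> s = 0"
  shows "negligible S"
proof (rule ccontr)
  assume "\<not> negligible S"
  then have m: "measure lebesgue S > 0"
    using S(1) by (simp add: negligible_iff_measure0 zero_less_measure_iff)
  obtain r where r: "S \<subseteq> ball 0 r" using bounded_subset_ballD[OF S(2), of 0] by blast
  define f where "f j = (+) ((1 / Suc j) *\<^sub>R e) ` S" for j :: nat
  have fm: "f j \<in> lmeasurable" "measure lebesgue (f j) = measure lebesgue S" for j
    unfolding f_def by (auto intro: measurable_translation S(1) simp: measure_translation)
  have "f i \<inter> f j = {}" if "i \<noteq> j" for i j
  proof (rule ccontr)
    assume "f i \<inter> f j \<noteq> {}"
    then obtain x y where xy: "x \<in> S" "y \<in> S" "(1 / Suc i) *\<^sub>R e + x = (1 / Suc j) *\<^sub>R e + y"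
      by (auto simp: f_def)
    then have "y = x + (1 / Suc i - 1 / Suc j) *\<^sub>R e" by (simp add: algebra_simps)
    then have "1 / real (Suc i) - 1 / real (Suc j) = 0" using disj xy by metis
    then show False using that by simp
  qed
  then have sum: "measure lebesgue (\<Union>(f ` {..<n})) = (\<Sum>j<n. measure lebesgue (f j))" for n
    by (intro measure_negligible_finite_Union_image) (auto simp: pairwise_def fm)
  have "real n * measure lebesgue S \<le> measure lebesgue (ball (0::'a) (r + 1))" for n
  proof -
    have "f j \<subseteq> ball 0 (r + 1)" for j
    proof
      fix y assume "y \<in> f j"
      then obtain x where x: "x \<in> S" "y = (1 / Suc j) *\<^sub>R e + x" by (auto simp: f_def)
      have "norm y \<le> norm ((1 / Suc j) *\<^sub>R e) + norm x" unfolding x(2) by (rule norm_triangle_ineq)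
      also have "\<dots> < 1 + r" using e r x(1) by (auto simp: subset_eq intro!: add_le_less_mono)
      finally show "y \<in> ball 0 (r + 1)" by simp
    qed
    then have "measure lebesgue (\<Union>(f ` {..<n})) \<le> measure lebesgue (ball (0::'a) (r + 1))"
      by (intro measure_mono_fmeasurable) (auto intro!: fmeasurableD fmeasurable.finite_UN fm)
    then show ?thesis by (simp add: sum fm)
  qed
  moreover obtain n :: nat where "measure lebesgue (ball (0::'a) (r + 1)) < real n * measure lebesgue S"
    using reals_Archimedean3[OF m] by blast
  ultimately show False by (meson not_less)
qed

text \<open>Locally the frontier is a graph over the coordinates other than \<open>k\<close>, so a
  line along axis \<open>k\<close> meets it at most once and translates along that axis are
  disjoint.\<close>

lemma negligible_frontier_C2alpha:
  fixes D :: "(real^'n::finite) set"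
  assumes "C2alpha_boundary \<alpha> D"
  shows "negligible (frontier D)"
  unfolding locally_negligible_alt[of "frontier D"]
proof
  fix p assume p: "p \<in> frontier D"
  then obtain r k \<gamma> where r: "r > 0" and ind: "\<And>x y. (\<forall>j. j \<noteq> k \<longrightarrow> x $ j = y $ j) \<Longrightarrow> \<gamma> x = \<gamma> y" and fr: "frontier D \<inter> ball p r = {x \<in> ball p r. x $ k = \<gamma> x}"
    using assms[unfolded C2alpha_boundary_def, rule_format, OF p] by (elim exE conjE) blast
  let ?S = "frontier D \<inter> ball p r"
  have "?S \<in> sets lebesgue" by (metis borel_closed borel_open frontier_closed open_ball sets.Int sets_completionI_sets sets_lborel)
  then have "?S \<in> lmeasurable" by (intro bounded_set_imp_lmeasurable bounded_Int) auto
  moreover have "s = 0" if "x \<in> ?S" "x + s *\<^sub>R axis k 1 \<in> ?S" for x s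
  proof -
    have "x $ k = \<gamma> x" "(x + s *\<^sub>R axis k 1) $ k = \<gamma> (x + s *\<^sub>R axis k 1)" using that unfolding fr by auto
    moreover have "\<gamma> (x + s *\<^sub>R axis k 1) = \<gamma> x" by (rule ind) (simp add: axis_def)
    ultimately show ?thesis by simp
  qed
  ultimately have "negligible ?S"
    by (intro negligible_disjoint_translates[where e="axis k 1"]) (auto intro: bounded_Int)
  moreover have "openin (top_of_set (frontier D)) ?S" by (simp add: openin_open_Int)
  ultimately show "\<exists>U. openin (top_of_set (frontier D)) U \<and> p \<in> U \<and> negligible U"
    using p r by (intro exI[of _ ?S]) auto
qed

subsection \<open>Reduction of the two-phase operator to the Laplacian\<close>

lemma integral_zero_outside:
  fixes f :: "'a::euclidean_space \<Rightarrow> real"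
  assumes "S \<subseteq> T" "\<And>x. x \<in> T \<Longrightarrow> x \<notin> S \<Longrightarrow> f x = 0"
  shows "integral T f = integral S f"
proof (rule integral_spike_set)
  have "{x \<in> T - S. f x \<noteq> 0} = {}" "{x \<in> S - T. f x \<noteq> 0} = {}" using assms by auto
  then show "negligible {x \<in> T - S. f x \<noteq> 0}" "negligible {x \<in> S - T. f x \<noteq> 0}"
    by (simp_all only: negligible_empty)
qed

lemma absolutely_integrable_zero_outside:
  fixes f :: "'a::euclidean_space \<Rightarrow> real"
  assumes "f absolutely_integrable_on S" "S \<subseteq> T" "\<And>x. x \<in> T \<Longrightarrow> x \<notin> S \<Longrightarrow> f x = 0"
  shows "f absolutely_integrable_on T"
proof -
  have "(\<lambda>x. if x \<in> S then f x else 0) absolutely_integrable_on UNIV"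
    using assms(1) by (simp add: absolutely_integrable_restrict_UNIV)
  moreover have "(\<lambda>x. if x \<in> S then f x else 0) = (\<lambda>x. if x \<in> T then f x else 0)"
    using assms(2,3) by (fastforce simp: fun_eq_iff)
  ultimately show ?thesis by (simp only: absolutely_integrable_restrict_UNIV)
qed

lemma test_fun_zero: "test_fun U \<phi> \<Longrightarrow> x \<notin> U \<Longrightarrow> \<phi> x = 0"
  using not_csupport[of x \<phi>] by (auto simp: test_fun_def)

lemma test_fun_mono: "test_fun U \<phi> \<Longrightarrow> U \<subseteq> W \<Longrightarrow> test_fun W \<phi>"
  by (auto simp: test_fun_def)

lemma test_fun_continuous: "test_fun U \<phi> \<Longrightarrow> continuous_on S \<phi>"
  by (auto simp: test_fun_def intro: smooth_D)

lemma integrable_mult_test_fun: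
  assumes "continuous_on UNIV g" "test_fun U \<phi>"
  shows "(\<lambda>x. g x * \<phi> x) absolutely_integrable_on UNIV"
proof (rule compact_support_absolutely_integrable)
  show "continuous_on UNIV (\<lambda>x. g x * \<phi> x)"
    using assms(1) test_fun_continuous[OF assms(2)] by (rule continuous_on_mult)
  show "bounded (csupport \<phi>)" using assms by (auto simp: test_fun_def compact_imp_bounded)
qed (simp add: not_csupport)

lemma absolutely_integrable_mult_test_fun:
  fixes f :: "real^'n::finite \<Rightarrow> real"
  assumes f: "f absolutely_integrable_on S" and S: "S \<in> sets lebesgue" and \<phi>: "test_fun U \<phi>"
  shows "(\<lambda>x. f x * \<phi> x) absolutely_integrable_on S"
proof -
  obtain C where C: "\<And>x. \<bar>\<phi> x\<bar> \<le> C" using test_fun_bounded[OF \<phi>] by blast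
  have "(\<lambda>x. \<phi> x * f x) absolutely_integrable_on S"
  proof (rule absolutely_integrable_bounded_measurable_product[OF bilinear_times _ S _ f])
    show "\<phi> \<in> borel_measurable (lebesgue_on S)"
      using continuous_imp_measurable_on_sets_lebesgue[OF test_fun_continuous[OF \<phi>] S] .
    show "bounded (\<phi> ` S)" using C by (auto simp: bounded_iff)
  qed
  then show ?thesis by (simp add: mult.commute)
qed

text \<open>A segment from \<open>x\<close> in \<open>D\<close> to a point outside crosses the
  frontier at some \<open>z\<close> with \<open>u z = d\<close>, so |u x - d| is at most M |x - z|.
  Only \<open>x\<close> and \<open>z\<close>, both in the closure of \<open>D\<close>, are compared
  through the Lipschitz bound; the segment itself may leave \<open>B\<close>.\<close>

lemma lipschitz_extension_by_zero:
  fixes u :: "real^'n::finite \<Rightarrow> real"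
  assumes u: "M-lipschitz_on B u" and D: "closure D \<subseteq> B" and bd: "\<And>x. x \<in> frontier D \<Longrightarrow> u x = d"
  shows "M-lipschitz_on UNIV (\<lambda>x. if x \<in> D then u x - d else 0)"
proof (rule lipschitz_onI)
  let ?g = "\<lambda>x. if x \<in> D then u x - d else 0"
  show M: "0 \<le> M" using u lipschitz_on_nonneg by blast
  have *: "dist (?g x) (?g y) \<le> M * dist x y" if x: "x \<in> D" for x y
  proof (cases "y \<in> D")
    case True
    then show ?thesis using lipschitz_onD[OF u, of x y] x D closure_subset by (auto simp: dist_real_def)
  next
    case False
    have "closed_segment x y \<inter> D \<noteq> {}" "closed_segment x y - D \<noteq> {}" using x False by auto
    then obtain z where z: "z \<in> closed_segment x y" "z \<in> frontier D"
      using connected_Int_frontier[OF connected_segment(1), of x y D] by blast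
    then have "z \<in> closure D" by (simp add: frontier_def)
    have "dist (u x) (u z) \<le> M * dist x z"
      using lipschitz_onD[OF u, of x z] x D closure_subset \<open>z \<in> closure D\<close> by auto
    also have "\<dots> \<le> M * dist x y"
      using z(1) M dist_in_closed_segment[of z x y] by (intro mult_left_mono) (auto simp: dist_commute)
    finally show ?thesis using bd[OF z(2)] x False by (simp add: dist_real_def)
  qed
  fix x y
  show "dist (?g x) (?g y) \<le> M * dist x y"
    using *[of x y] *[of y x] M by (cases "x \<in> D"; cases "y \<in> D") (auto simp: dist_commute)
qed

text \<open>Difference quotients of \<open>g\<close> are bounded by \<open>M\<close> and vanish
  unless the point or its shift lies in \<open>D\<close>. The resulting bound contains no derivative
  of \<zeta>, only its mass in \<open>D\<close>, which is what makes cutoffs with wild derivatives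
  harmless.\<close>

lemma lipschitz_weak_derivative_bound:
  fixes g :: "real^'n::finite \<Rightarrow> real"
  assumes g: "M-lipschitz_on UNIV g" "\<And>x. x \<notin> D \<Longrightarrow> g x = 0"
    and D: "open D" "negligible (frontier D)" and \<zeta>: "test_fun UNIV \<zeta>"
  shows "\<bar>integral UNIV (\<lambda>x. g x * pd i \<zeta> x)\<bar> \<le> M * integral D (\<lambda>x. \<bar>\<zeta> x\<bar>)"
proof -
  define h where "h n = 1 / real (Suc n)" for n
  have h: "h n > 0" for n by (simp add: h_def)
  let ?e = "axis i 1 :: real^'n"
  let ?q = "\<lambda>n x. (g (x + h n *\<^sub>R ?e) - g x) / h n * \<zeta> x"
  have M: "M \<ge> 0" using g(1) lipschitz_on_nonneg by blast
  have cg: "continuous_on UNIV g" using g(1) by (rule lipschitz_on_continuous_on)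
  define A where "A n = {x. x \<in> D \<or> x + h n *\<^sub>R ?e \<in> D}" for n
  have "A n = D \<union> (\<lambda>x. x + h n *\<^sub>R ?e) -` D" for n by (auto simp: A_def)
  moreover have "open ((\<lambda>x. x + h n *\<^sub>R ?e) -` D)" for n
    using D(1) by (intro open_vimage continuous_intros)
  ultimately have "open (A n)" for n using D(1) by auto
  then have Am: "A n \<in> sets lebesgue" for n by auto
  define B where "B n x = (if x \<in> A n then M * \<bar>\<zeta> x\<bar> else 0)" for n x
  define S where "S = - frontier D"
  have "open S" unfolding S_def by (intro open_Compl frontier_closed)
  \<comment> \<open>Off the frontier the indicators of \<open>A n\<close> converge to the indicator
    of \<open>D\<close>; on the frontier they need not, so this null set is left out.\<close>
  then have Sm: "S \<in> sets lebesgue" by auto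
  have "\<zeta> absolutely_integrable_on UNIV" using integrable_mult_test_fun[of "\<lambda>_. 1", OF _ \<zeta>] by simp
  then have \<zeta>i: "(\<lambda>x. M * \<bar>\<zeta> x\<bar>) absolutely_integrable_on UNIV"
    by (intro set_integrable_mult_right set_integrable_abs)
  have Ba: "B n absolutely_integrable_on UNIV" for n
    unfolding B_def absolutely_integrable_restrict_UNIV
    by (rule set_integrable_subset[OF \<zeta>i]) (use Am in auto)
  have qi: "?q n integrable_on UNIV" for n
  proof -
    have "continuous_on UNIV (\<lambda>x. (g (x + h n *\<^sub>R ?e) - g x) / h n)"
      using h[of n] by (intro continuous_intros continuous_on_compose2[OF cg]) auto
    then show ?thesis using integrable_mult_test_fun[OF _ \<zeta>] set_lebesgue_integral_eq_integral(1) by blast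
  qed
  have qB: "norm (?q n x) \<le> B n x" for n x
  proof (cases "x \<in> A n")
    case True
    have "\<bar>g (x + h n *\<^sub>R ?e) - g x\<bar> \<le> M * h n"
      using lipschitz_onD[OF g(1), of "x + h n *\<^sub>R ?e" x] h[of n] by (simp add: dist_real_def dist_norm)
    then have "\<bar>(g (x + h n *\<^sub>R ?e) - g x) / h n\<bar> \<le> M" using h[of n] by (simp add: field_simps)
    then have "\<bar>(g (x + h n *\<^sub>R ?e) - g x) / h n\<bar> * \<bar>\<zeta> x\<bar> \<le> M * \<bar>\<zeta> x\<bar>" by (intro mult_right_mono) auto
    then show ?thesis using True by (simp only: B_def if_True real_norm_def abs_mult)
  next
    case False
    then show ?thesis using g(2) by (simp add: B_def A_def)
  qed
  define B' where "B' x = (if x \<in> D then M * \<bar>\<zeta> x\<bar> else 0)" for x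
  have "(\<lambda>n. integral S (B n)) \<longlonglongrightarrow> integral S B'"
  proof (rule dominated_convergence(2)[where h="\<lambda>x. M * \<bar>\<zeta> x\<bar>"])
    show "B n integrable_on S" for n
      by (intro set_lebesgue_integral_eq_integral(1) set_integrable_subset[OF Ba]) (use Sm in auto)
    show "(\<lambda>x. M * \<bar>\<zeta> x\<bar>) integrable_on S"
      by (intro set_lebesgue_integral_eq_integral(1) set_integrable_subset[OF \<zeta>i]) (use Sm in auto)
    show "norm (B n x) \<le> M * \<bar>\<zeta> x\<bar>" for n x using M by (simp add: B_def)
    show "(\<lambda>n. B n x) \<longlonglongrightarrow> B' x" if "x \<in> S" for x
    proof (cases "x \<in> D")
      case True
      then show ?thesis by (simp add: B_def B'_def A_def)
    next
      case False
      then have x: "x \<in> - closure D" using that D(1) by (auto simp: S_def frontier_def interior_open)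
      have "(\<lambda>n. x + h n *\<^sub>R ?e) \<longlonglongrightarrow> x + 0 *\<^sub>R ?e"
        unfolding h_def using LIMSEQ_inverse_real_of_nat
        by (intro tendsto_intros) (simp add: inverse_eq_divide)
      then have "\<forall>\<^sub>F n in sequentially. x + h n *\<^sub>R ?e \<in> - closure D"
        using x by (intro topological_tendstoD) auto
      then have "\<forall>\<^sub>F n in sequentially. B' x = B n x"
      proof (rule eventually_mono)
        fix n assume "x + h n *\<^sub>R ?e \<in> - closure D"
        then have "x + h n *\<^sub>R ?e \<notin> D" using closure_subset by blast
        then show "B' x = B n x" using False by (simp add: B_def B'_def A_def)
      qed
      then show ?thesis by (rule tendsto_eventually[OF eventually_mono]) simp
    qed
  qed
  moreover have Beq: "integral UNIV f = integral S f" for f :: "real^'n \<Rightarrow> real"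
  proof (rule integral_spike_set)
    show "negligible {x \<in> UNIV - S. f x \<noteq> 0}" by (rule negligible_subset[OF D(2)]) (auto simp: S_def)
  qed simp
  moreover have "integral UNIV B' = M * integral D (\<lambda>x. \<bar>\<zeta> x\<bar>)"
    unfolding B'_def integral_restrict_UNIV by (rule integral_mult_right)
  ultimately have limB: "(\<lambda>n. integral UNIV (B n)) \<longlonglongrightarrow> M * integral D (\<lambda>x. \<bar>\<zeta> x\<bar>)" by simp
  have "(\<lambda>n. \<bar>integral UNIV (?q n)\<bar>) \<longlonglongrightarrow> \<bar>- integral UNIV (\<lambda>x. g x * pd i \<zeta> x)\<bar>"
    using difference_quotient_pairing[OF cg \<zeta>, of i] unfolding h_def by (rule tendsto_rabs)
  moreover have "\<bar>integral UNIV (?q n)\<bar> \<le> integral UNIV (B n)" for n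
    using integral_norm_bound_integral[OF qi set_lebesgue_integral_eq_integral(1)[OF Ba] qB] by simp
  ultimately have "\<bar>- integral UNIV (\<lambda>x. g x * pd i \<zeta> x)\<bar> \<le> M * integral D (\<lambda>x. \<bar>\<zeta> x\<bar>)"
    using limB by (intro LIMSEQ_le) auto
  then show ?thesis by simp
qed

lemma test_fun_mult:
  assumes "test_fun U f" "smooth g" shows "test_fun U (\<lambda>x. f x * g x)"
  using assms by (intro test_fun_subset[OF smooth_mult csupport_mult]) (auto simp: test_fun_def)

text \<open>A test function on \<open>U\<close> need not vanish at the interface. It is split into
  \<zeta> = \<eta> \<psi>, supported in \<open>D\<close>, where the weak gradient of
  \<open>u\<close> applies, and a rest \<rho> whose contribution is at most \<open>M\<close> times
  its mass in \<open>D\<close> and tends to 0. Thus no interface term arises.\<close>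

lemma weak_grad_truncation:
  fixes u :: "real^'n::finite \<Rightarrow> real"
  assumes G: "weak_grad_on U u G" and D: "open D" "negligible (frontier D)" "bounded D" "closure D \<subseteq> U"
    and lip: "M-lipschitz_on UNIV (\<lambda>x. if x \<in> D then u x - d else 0)"
    and \<psi>: "test_fun U \<psi>"
  shows "integral D (\<lambda>x. G x $ i * \<psi> x) = - integral UNIV (\<lambda>x. (if x \<in> D then u x - d else 0) * pd i \<psi> x)"
proof -
  define g where "g x = (if x \<in> D then u x - d else 0)" for x
  have lip: "M-lipschitz_on UNIV g" using lip by (simp add: g_def[abs_def])
  have cg: "continuous_on UNIV g" using lip by (rule lipschitz_on_continuous_on)
  have DU: "D \<subseteq> U" using D(4) closure_subset by blast
  have \<psi>': "test_fun UNIV \<psi>" using \<psi> by (rule test_fun_mono) simp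
  obtain \<eta> :: "nat \<Rightarrow> real^'n \<Rightarrow> real" where \<eta>: "\<And>n. test_fun D (\<eta> n)" "\<And>n x. 0 \<le> \<eta> n x" "\<And>n x. \<eta> n x \<le> 1"
      "\<And>x. x \<in> D \<Longrightarrow> (\<lambda>n. \<eta> n x) \<longlonglongrightarrow> 1"
    using open_smooth_cutoffs[OF D(1)] by blast
  define \<zeta> where "\<zeta> n x = \<eta> n x * \<psi> x" for n x
  define \<rho> where "\<rho> n x = \<psi> x * (1 - \<eta> n x)" for n x
  have \<zeta>: "test_fun D (\<zeta> n)" for n
    unfolding \<zeta>_def using \<psi> by (intro test_fun_mult \<eta>) (auto simp: test_fun_def)
  have \<rho>: "test_fun UNIV (\<rho> n)" for n
    unfolding \<rho>_def using \<eta>(1) by (intro test_fun_mult \<psi>' smooth_one_minus) (auto simp: test_fun_def)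
  have \<psi>eq: "\<psi> = (\<lambda>x. \<zeta> n x + \<rho> n x)" for n by (auto simp: \<zeta>_def \<rho>_def algebra_simps)
  have Dm: "D \<in> sets lebesgue" using D(1) by auto
  have "compact (closure D)" using D(3) by (simp add: compact_closure)
  then have "(\<lambda>x. G x $ i) absolutely_integrable_on closure D"
    using G D(4) by (auto simp: weak_grad_on_def)
  then have "(\<lambda>x. G x $ i) absolutely_integrable_on D"
    by (rule set_integrable_subset) (use Dm closure_subset in auto)
  then have Gi: "(\<lambda>x. G x $ i * f x) absolutely_integrable_on D" if "test_fun W f" for f W
    using that Dm by (intro absolutely_integrable_mult_test_fun)
  have gi: "(\<lambda>x. g x * pd i f x) integrable_on UNIV" if "test_fun W f" for f W
    by (intro set_lebesgue_integral_eq_integral(1) integrable_mult_test_fun[OF cg test_fun_pd[OF that]])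
  have weak: "integral D (\<lambda>x. G x $ i * \<zeta> n x) = - integral UNIV (\<lambda>x. g x * pd i (\<zeta> n) x)" for n
  proof -
    have "test_fun U (\<zeta> n)" using \<zeta> DU by (rule test_fun_mono)
    then have "integral U (\<lambda>x. u x * pd i (\<zeta> n) x) = - integral U (\<lambda>x. G x $ i * \<zeta> n x)"
      using G by (auto simp: weak_grad_on_def)
    moreover have "integral U (\<lambda>x. G x $ i * \<zeta> n x) = integral D (\<lambda>x. G x $ i * \<zeta> n x)"
      using test_fun_zero[OF \<zeta>] by (intro integral_zero_outside DU) auto
    moreover have "integral U (\<lambda>x. u x * pd i (\<zeta> n) x) = integral UNIV (\<lambda>x. g x * pd i (\<zeta> n) x)"
    proof -
      have z: "pd i (\<zeta> n) x = 0" if "x \<notin> D" for x using test_fun_zero[OF test_fun_pd[OF \<zeta>] that] .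
      have "integral U (\<lambda>x. u x * pd i (\<zeta> n) x) = integral D (\<lambda>x. u x * pd i (\<zeta> n) x)"
        using z by (intro integral_zero_outside DU) auto
      \<comment> \<open>On \<open>D\<close> the function \<open>u\<close> is \<open>g + d\<close>;
        the constant contributes nothing, since a derivative of a test function integrates to
        0.\<close>
      also have "\<dots> = integral D (\<lambda>x. g x * pd i (\<zeta> n) x + d * pd i (\<zeta> n) x)"
        by (rule integral_cong) (simp add: g_def algebra_simps)
      also have "\<dots> = integral UNIV (\<lambda>x. g x * pd i (\<zeta> n) x + d * pd i (\<zeta> n) x)"
        using z by (intro integral_zero_outside[symmetric]) auto
      also have "\<dots> = integral UNIV (\<lambda>x. g x * pd i (\<zeta> n) x) + integral UNIV (\<lambda>x. d * pd i (\<zeta> n) x)"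
        by (intro integral_add gi[OF \<zeta>] set_lebesgue_integral_eq_integral(1)
            integrable_mult_test_fun[OF continuous_on_const test_fun_pd[OF \<zeta>]])
      also have "integral UNIV (\<lambda>x. d * pd i (\<zeta> n) x) = d * integral UNIV (pd i (\<zeta> n))" by simp
      also have "integral UNIV (pd i (\<zeta> n)) = 0"
        by (rule integral_pd_eq_0, rule test_fun_mono[OF \<zeta>]) simp
      finally show ?thesis by simp
    qed
    ultimately show ?thesis by simp
  qed
  have limG: "(\<lambda>n. integral D (\<lambda>x. G x $ i * \<zeta> n x)) \<longlonglongrightarrow> integral D (\<lambda>x. G x $ i * \<psi> x)"
  proof (rule dominated_convergence(2)[where h="\<lambda>x. \<bar>G x $ i * \<psi> x\<bar>"])
    show "(\<lambda>x. G x $ i * \<zeta> n x) integrable_on D" for n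
      by (intro set_lebesgue_integral_eq_integral(1) Gi[OF \<zeta>])
    show "(\<lambda>x. \<bar>G x $ i * \<psi> x\<bar>) integrable_on D"
      by (intro set_lebesgue_integral_eq_integral(1) set_integrable_abs Gi[OF \<psi>])
    show "norm (G x $ i * \<zeta> n x) \<le> \<bar>G x $ i * \<psi> x\<bar>" for n x
    proof -
      have "\<bar>\<eta> n x\<bar> \<le> 1" using \<eta>(2,3)[of n x] by simp
      then have "\<bar>\<eta> n x\<bar> * \<bar>G x $ i * \<psi> x\<bar> \<le> 1 * \<bar>G x $ i * \<psi> x\<bar>" by (intro mult_right_mono) auto
      then show ?thesis by (simp add: \<zeta>_def abs_mult mult_ac)
    qed
    show "(\<lambda>n. G x $ i * \<zeta> n x) \<longlonglongrightarrow> G x $ i * \<psi> x" if "x \<in> D" for x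
      unfolding \<zeta>_def using tendsto_mult[OF tendsto_const tendsto_mult[OF \<eta>(4)[OF that] tendsto_const], of "G x $ i" "\<psi> x"] by simp
  qed
  have limg: "(\<lambda>n. integral UNIV (\<lambda>x. g x * pd i (\<zeta> n) x)) \<longlonglongrightarrow> integral UNIV (\<lambda>x. g x * pd i \<psi> x)"
  proof -
    have "(\<lambda>n. integral D (\<lambda>x. \<bar>\<rho> n x\<bar>)) \<longlonglongrightarrow> integral D (\<lambda>x. 0)"
    proof (rule dominated_convergence(2)[where h="\<lambda>x. \<bar>\<psi> x\<bar>"])
      have ai: "f absolutely_integrable_on D" if "test_fun UNIV f" for f
        by (rule set_integrable_subset[of _ UNIV]) (use integrable_mult_test_fun[of "\<lambda>_. 1", OF _ that] Dm in auto)
      show "(\<lambda>x. \<bar>\<rho> n x\<bar>) integrable_on D" for n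
        by (intro set_lebesgue_integral_eq_integral(1) set_integrable_abs ai \<rho>)
      show "(\<lambda>x. \<bar>\<psi> x\<bar>) integrable_on D"
        by (intro set_lebesgue_integral_eq_integral(1) set_integrable_abs ai \<psi>')
      show "norm \<bar>\<rho> n x\<bar> \<le> \<bar>\<psi> x\<bar>" for n x
      proof -
        have "\<bar>1 - \<eta> n x\<bar> \<le> 1" using \<eta>(2,3)[of n x] by simp
        then have "\<bar>\<psi> x\<bar> * \<bar>1 - \<eta> n x\<bar> \<le> \<bar>\<psi> x\<bar> * 1" by (intro mult_left_mono) auto
        then show ?thesis by (simp add: \<rho>_def abs_mult)
      qed
      show "(\<lambda>n. \<bar>\<rho> n x\<bar>) \<longlonglongrightarrow> 0" if "x \<in> D" for x
      proof -
        have "(\<lambda>n. \<bar>\<rho> n x\<bar>) \<longlonglongrightarrow> \<bar>\<psi> x * (1 - 1)\<bar>"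
          unfolding \<rho>_def by (intro tendsto_intros \<eta>(4) that)
        then show ?thesis by simp
      qed
    qed
    then have lim0: "(\<lambda>n. M * integral D (\<lambda>x. \<bar>\<rho> n x\<bar>)) \<longlonglongrightarrow> 0"
      using tendsto_mult[OF tendsto_const[of M]] by fastforce
    have "(\<lambda>n. integral UNIV (\<lambda>x. g x * pd i (\<rho> n) x)) \<longlonglongrightarrow> 0"
    proof (rule Lim_null_comparison[OF _ lim0])
      show "\<forall>\<^sub>F n in sequentially. norm (integral UNIV (\<lambda>x. g x * pd i (\<rho> n) x)) \<le> M * integral D (\<lambda>x. \<bar>\<rho> n x\<bar>)"
        using lipschitz_weak_derivative_bound[OF lip _ D(1,2) \<rho>] by (simp add: g_def)
    qed
    moreover have "integral UNIV (\<lambda>x. g x * pd i (\<zeta> n) x) = integral UNIV (\<lambda>x. g x * pd i \<psi> x) - integral UNIV (\<lambda>x. g x * pd i (\<rho> n) x)" for n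
    proof -
      have "pd i \<psi> x = pd i (\<zeta> n) x + pd i (\<rho> n) x" for x
        using \<zeta>[of n] \<rho>[of n] unfolding \<psi>eq[of n] by (intro pd_add smooth_D) (auto simp: test_fun_def)
      then have "integral UNIV (\<lambda>x. g x * pd i \<psi> x) = integral UNIV (\<lambda>x. g x * pd i (\<zeta> n) x + g x * pd i (\<rho> n) x)"
        by (simp add: algebra_simps)
      also have "\<dots> = integral UNIV (\<lambda>x. g x * pd i (\<zeta> n) x) + integral UNIV (\<lambda>x. g x * pd i (\<rho> n) x)"
        by (intro integral_add gi[OF \<zeta>] gi[OF \<rho>])
      finally show ?thesis by simp
    qed
    ultimately show ?thesis using tendsto_diff[OF tendsto_const] by fastforce
  qed
  have "integral D (\<lambda>x. G x $ i * \<psi> x) = - integral UNIV (\<lambda>x. g x * pd i \<psi> x)"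
    by (rule LIMSEQ_unique[OF limG[unfolded weak] tendsto_minus[OF limg]])
  then show ?thesis by (simp add: g_def)
qed

text \<open>Since \<open>u = d\<close> on the interface, multiplying \<open>u - d\<close> by \<open>\<sigma>\<close> gives a continuous function whose
  distributional Laplacian is the divergence of \<open>\<sigma> \<nabla> u\<close>: the two-phase operator becomes the Laplacian.\<close>

lemma transmission_laplacian:
  fixes u :: "real^'n::finite \<Rightarrow> real"
  assumes G: "weak_grad_on U u G" and D: "open D" "negligible (frontier D)" "bounded D" "closure D \<subseteq> U"
    and U: "open U"
    and lip: "M-lipschitz_on UNIV (\<lambda>x. if x \<in> D then u x - d else 0)"
    and cu: "continuous_on UNIV (\<lambda>x. if x \<in> U then u x else 0)"
    and \<phi>: "test_fun U \<phi>"
  shows "integral U (\<lambda>x. (if x \<in> D then \<sigma>p else \<sigma>m) * (G x \<bullet> grad \<phi> x)) =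
    - integral UNIV (\<lambda>x. (\<sigma>m * (if x \<in> U then u x else 0) + (\<sigma>p - \<sigma>m) * (if x \<in> D then u x - d else 0)) * laplacian \<phi> x)"
proof -
  define g where "g x = (if x \<in> D then u x - d else 0)" for x
  define w where "w x = (if x \<in> U then u x else 0)" for x
  let ?V = "\<lambda>x. \<sigma>m * w x + (\<sigma>p - \<sigma>m) * g x"
  have cg: "continuous_on UNIV g" using lipschitz_on_continuous_on[OF lip] by (simp add: g_def[abs_def])
  have cw: "continuous_on UNIV w" using cu by (simp add: w_def[abs_def])
  have DU: "D \<subseteq> U" using D(4) closure_subset by blast
  have Dm: "D \<in> sets lebesgue" using D(1) by auto
  \<comment> \<open>\<open>G\<close> is integrable only on compact subsets of \<open>U\<close>, so
    integrability over \<open>U\<close> is drawn from the compact support of the test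
    function.\<close>
  have Gi: "(\<lambda>x. G x $ i * \<psi> x) absolutely_integrable_on U" if \<psi>: "test_fun U \<psi>" for i \<psi>
  proof (rule absolutely_integrable_zero_outside)
    have K: "compact (csupport \<psi>)" "csupport \<psi> \<subseteq> U" using \<psi> by (auto simp: test_fun_def)
    then have "(\<lambda>x. G x $ i) absolutely_integrable_on csupport \<psi>" using G by (auto simp: weak_grad_on_def)
    then show "(\<lambda>x. G x $ i * \<psi> x) absolutely_integrable_on csupport \<psi>"
      using \<psi> K by (intro absolutely_integrable_mult_test_fun) (auto intro: lmeasurable_compact fmeasurableD)
    show "csupport \<psi> \<subseteq> U" by fact
  qed (simp add: not_csupport)
  have *: "(\<lambda>x. (if x \<in> D then \<sigma>p else \<sigma>m) * (G x $ i * pd i \<phi> x)) integrable_on U \<and>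
      integral U (\<lambda>x. (if x \<in> D then \<sigma>p else \<sigma>m) * (G x $ i * pd i \<phi> x)) = - integral UNIV (\<lambda>x. ?V x * pd i (pd i \<phi>) x)" for i
  proof -
    let ?\<psi> = "pd i \<phi>"
    let ?f = "\<lambda>x. G x $ i * ?\<psi> x"
    have \<psi>: "test_fun U ?\<psi>" using \<phi> by (rule test_fun_pd)
    \<comment> \<open>The coefficient is \<open>\<sigma>m\<close> plus
      \<open>\<sigma>p - \<sigma>m\<close> times the indicator of \<open>D\<close>: the first part
      uses the weak gradient on all of \<open>U\<close>, the second the truncated one.\<close>
    have eq: "(\<lambda>x. (if x \<in> D then \<sigma>p else \<sigma>m) * ?f x) = (\<lambda>x. \<sigma>m * ?f x + (\<sigma>p - \<sigma>m) * (if x \<in> D then ?f x else 0))"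
      by (auto simp: algebra_simps)
    have i1: "?f integrable_on U" using Gi[OF \<psi>] by (rule set_lebesgue_integral_eq_integral(1))
    have fD: "?f absolutely_integrable_on D"
      by (rule set_integrable_subset[OF Gi[OF \<psi>] _ DU]) (use Dm in auto)
    have i2: "(\<lambda>x. if x \<in> D then ?f x else 0) integrable_on U"
    proof (rule set_lebesgue_integral_eq_integral(1), rule absolutely_integrable_zero_outside[OF _ DU])
      show "(\<lambda>x. if x \<in> D then ?f x else 0) absolutely_integrable_on D"
        using fD by (subst set_integrable_cong[OF refl refl, where f'="?f"]) auto
    qed simp
    have "integral U (\<lambda>x. \<sigma>m * ?f x + (\<sigma>p - \<sigma>m) * (if x \<in> D then ?f x else 0))
        = \<sigma>m * integral U ?f + (\<sigma>p - \<sigma>m) * integral U (\<lambda>x. if x \<in> D then ?f x else 0)"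
      using integral_add[OF integrable_on_mult_right[OF i1] integrable_on_mult_right[OF i2]]
      by (simp only: integral_mult_right)
    also have "integral U (\<lambda>x. if x \<in> D then ?f x else 0) = integral D ?f"
      by (subst integral_zero_outside[OF DU]) (auto intro: integral_cong)
    also have "integral D ?f = - integral UNIV (\<lambda>x. g x * pd i ?\<psi> x)"
      using weak_grad_truncation[OF G D lip \<psi>, of i] by (simp add: g_def)
    also have "integral U ?f = - integral UNIV (\<lambda>x. w x * pd i ?\<psi> x)"
    proof -
      have "integral U ?f = - integral U (\<lambda>x. u x * pd i ?\<psi> x)" using G \<psi> by (auto simp: weak_grad_on_def)
      also have "integral U (\<lambda>x. u x * pd i ?\<psi> x) = integral U (\<lambda>x. w x * pd i ?\<psi> x)"
        by (rule integral_cong) (simp add: w_def)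
      also have "\<dots> = integral UNIV (\<lambda>x. w x * pd i ?\<psi> x)"
        by (rule integral_zero_outside[symmetric]) (auto simp: w_def)
      finally show ?thesis .
    qed
    also have "\<sigma>m * (- integral UNIV (\<lambda>x. w x * pd i ?\<psi> x)) + (\<sigma>p - \<sigma>m) * (- integral UNIV (\<lambda>x. g x * pd i ?\<psi> x))
       = - integral UNIV (\<lambda>x. ?V x * pd i ?\<psi> x)"
    proof -
      have j: "(\<lambda>x. h x * pd i ?\<psi> x) integrable_on UNIV" if "continuous_on UNIV h" for h
        by (rule set_lebesgue_integral_eq_integral(1), rule integrable_mult_test_fun[OF that test_fun_pd[OF \<psi>]])
      have "(\<lambda>x. ?V x * pd i ?\<psi> x) = (\<lambda>x. \<sigma>m * (w x * pd i ?\<psi> x) + (\<sigma>p - \<sigma>m) * (g x * pd i ?\<psi> x))"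
        by (simp add: algebra_simps)
      moreover have "integral UNIV (\<lambda>x. \<sigma>m * (w x * pd i ?\<psi> x) + (\<sigma>p - \<sigma>m) * (g x * pd i ?\<psi> x))
        = \<sigma>m * integral UNIV (\<lambda>x. w x * pd i ?\<psi> x) + (\<sigma>p - \<sigma>m) * integral UNIV (\<lambda>x. g x * pd i ?\<psi> x)"
        using integral_add[OF integrable_on_mult_right[OF j[OF cw]] integrable_on_mult_right[OF j[OF cg]]]
        by (simp only: integral_mult_right)
      ultimately show ?thesis by simp
    qed
    finally have "integral U (\<lambda>x. (if x \<in> D then \<sigma>p else \<sigma>m) * ?f x) = - integral UNIV (\<lambda>x. ?V x * pd i ?\<psi> x)"
      unfolding eq .
    moreover have "(\<lambda>x. (if x \<in> D then \<sigma>p else \<sigma>m) * ?f x) integrable_on U"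
      unfolding eq by (intro integrable_add integrable_on_mult_right i1 i2)
    ultimately show ?thesis by blast
  qed
  have "(\<lambda>x. (if x \<in> D then \<sigma>p else \<sigma>m) * (G x \<bullet> grad \<phi> x))
      = (\<lambda>x. \<Sum>i\<in>UNIV. (if x \<in> D then \<sigma>p else \<sigma>m) * (G x $ i * pd i \<phi> x))"
    by (simp add: inner_vec_def grad_def sum_distrib_left)
  then have "integral U (\<lambda>x. (if x \<in> D then \<sigma>p else \<sigma>m) * (G x \<bullet> grad \<phi> x))
      = (\<Sum>i\<in>UNIV. - integral UNIV (\<lambda>x. ?V x * pd i (pd i \<phi>) x))"
    using * by (simp add: integral_sum)
  also have "\<dots> = - integral UNIV (\<lambda>x. \<Sum>i\<in>UNIV. ?V x * pd i (pd i \<phi>) x)"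
  proof -
    have "continuous_on UNIV ?V" using cw cg by (intro continuous_intros)
    then have "(\<lambda>x. ?V x * pd i (pd i \<phi>) x) integrable_on UNIV" for i
      by (intro set_lebesgue_integral_eq_integral(1) integrable_mult_test_fun[OF _ test_fun_pd[OF test_fun_pd[OF \<phi>]]])
    then show ?thesis by (simp add: integral_sum sum_negf)
  qed
  also have "(\<lambda>x. \<Sum>i\<in>UNIV. ?V x * pd i (pd i \<phi>) x) = (\<lambda>x. ?V x * laplacian \<phi> x)"
    by (simp add: laplacian_def sum_distrib_left)
  finally show ?thesis by (simp add: g_def w_def)
qed

subsection \<open>Radial symmetry\<close>

lemma weakly_superharmonic_submean:
  assumes "continuous_on UNIV V" "r > 0"
    and "\<And>t. 0 < t \<Longrightarrow> t < r \<Longrightarrow> integral UNIV (\<lambda>x. V x * laplacian (bump 1 a t) x) \<le> 0"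
  shows "submean (\<lambda>x. - V x) a"
proof -
  have "0 \<le> integral UNIV (\<lambda>x. (- V x - - V a) * mean_kernel a t x)" if "0 < t" "t < r" for t
  proof -
    have "(\<lambda>x. (- V x - - V a) * mean_kernel a t x) = (\<lambda>x. - ((V x - V a) * mean_kernel a t x))"
      by (simp add: algebra_simps)
    then show ?thesis using weakly_superharmonic_mean[OF assms(1,3) that] by simp
  qed
  then show ?thesis using assms(2) by (auto simp: submean_def)
qed

text \<open>Connectedness and \<open>0 \<in> D\<close> make the norms attained on \<open>D\<close>
  an interval starting at 0, so invariance lets the norm be decreased inside \<open>D\<close>.
  Openness excludes the sphere whose radius is the supremum.\<close>

lemma rotation_invariant_domain_is_ball:
  fixes D :: "'a::euclidean_space set"
  assumes D: "open D" "connected D" "bounded D" "0 \<in> D"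
    and sym: "\<And>x y. norm x = norm y \<Longrightarrow> x \<in> D \<Longrightarrow> y \<in> D"
  shows "\<exists>r>0. D = ball 0 r"
proof -
  have down: "x \<in> D" if "z \<in> D" "norm x \<le> norm z" for x z
  proof -
    have "connected (norm ` D)" using D(2) by (intro connected_continuous_image continuous_intros)
    moreover have "0 \<in> norm ` D" "norm z \<in> norm ` D" using D(4) that(1) by (auto intro: image_eqI[of _ _ 0])
    ultimately have "{0..norm z} \<subseteq> norm ` D" by (rule connected_contains_Icc)
    then have "norm x \<in> norm ` D" using that(2) by auto
    then obtain y where "y \<in> D" "norm y = norm x" by auto
    then show ?thesis using sym by blast
  qed
  define r where "r = Sup (norm ` D)"
  have bdd: "bdd_above (norm ` D)" using D(3) by (auto simp: bounded_iff bdd_above_def)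
  have "D \<subseteq> cball 0 r" using cSup_upper[OF imageI bdd] by (auto simp: r_def)
  then have "D \<subseteq> ball 0 r" using D(1) interior_maximal interior_cball by metis
  moreover have "ball 0 r \<subseteq> D"
  proof
    fix x :: 'a assume "x \<in> ball 0 r"
    then have "norm x < Sup (norm ` D)" by (simp add: r_def)
    then obtain z where "z \<in> D" "norm x < norm z"
      using bdd D(4) less_cSup_iff[of "norm ` D" "norm x"] by blast
    then show "x \<in> D" using down[of z x] by simp
  qed
  ultimately have "D = ball 0 r" by blast
  moreover from this have "r > 0" using D(4) by simp
  ultimately show ?thesis by blast
qed

theorem theorem1p3:
  fixes D :: "(real^'n) set" and \<psi> u :: "real^'n \<Rightarrow> real"
    and \<alpha> \<sigma>p \<sigma>m L d :: real
  assumes N2: "CARD('n) \<ge> 2"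
    and Ddom: "open D" "connected D" "bounded D" "(0::real^'n) \<in> D"
    and alpha: "0 < \<alpha>" "\<alpha> < 1"
    and Dbdry: "C2alpha_boundary \<alpha> D"
    and sig: "\<sigma>p > 0" "\<sigma>m > 0" "\<sigma>p \<noteq> \<sigma>m"
    and psi_reg: "Ck_closure 2 D \<psi>" "continuous_on UNIV \<psi>"
    and psi_max: "\<exists>x. \<psi> x > 0"
    and psi_rad: "radial \<psi> UNIV"
    and psi_supp: "closure {x. \<psi> x > 0} \<subseteq> D"
    and L: "L > 0" "closure D \<subseteq> ball 0 L"
    and u_reg: "C11_closure D u" "C01 (cball 0 L) u"
    and u_sol: "obstacle_solution (\<lambda>x. if x \<in> D then \<sigma>p else \<sigma>m) \<psi> (ball 0 L) u"
    and u_bd: "d > 0" "\<forall>x\<in>frontier D. u x = d"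
  shows "radial u (cball 0 L) \<and> (\<exists>r>0. D = ball 0 r)"
proof -
  let ?U = "ball (0::real^'n) L"
  obtain M where M: "M-lipschitz_on (cball 0 L) u" using u_reg(2) by (auto simp: C01_def)
  have cu: "continuous_on (cball 0 L) u" using M by (rule lipschitz_on_continuous_on)
  have u\<psi>: "\<psi> x \<le> u x" if "x \<in> ?U" for x using u_sol that by (auto simp: obstacle_solution_def)
  have u0: "u x = 0" if "norm x = L" for x
    using u_sol that L(1) by (auto simp: obstacle_solution_def frontier_ball)
  obtain G where G: "weak_grad_on ?U u G"
    and sup: "\<And>\<phi>. test_fun ?U \<phi> \<Longrightarrow> (\<And>x. \<phi> x \<ge> 0) \<Longrightarrow>
      integral ?U (\<lambda>x. (if x \<in> D then \<sigma>p else \<sigma>m) * (G x \<bullet> grad \<phi> x)) \<ge> 0"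
    and free: "\<And>\<phi>. test_fun {x \<in> ?U. u x > \<psi> x} \<phi> \<Longrightarrow>
      integral ?U (\<lambda>x. (if x \<in> D then \<sigma>p else \<sigma>m) * (G x \<bullet> grad \<phi> x)) = 0"
    using u_sol unfolding obstacle_solution_def by blast
  have DU: "D \<subseteq> ?U" using L(2) closure_subset by blast
  define g where "g x = (if x \<in> D then u x - d else 0)" for x
  define w where "w x = (if x \<in> ?U then u x else 0)" for x
  \<comment> \<open>This form, rather than cases at the interface, gives continuity at once and
    matches the splitting of the coefficient.\<close>
  define V where "V x = \<sigma>m * w x + (\<sigma>p - \<sigma>m) * g x" for x
  have lip: "M-lipschitz_on UNIV g"
    unfolding g_def by (rule lipschitz_extension_by_zero[OF M]) (use L(2) ball_subset_cball u_bd(2) in auto)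
  then have cg: "continuous_on UNIV g" by (rule lipschitz_on_continuous_on)
  have cw: "continuous_on UNIV w"
  proof -
    have "continuous_on (cball 0 L \<union> - ?U) w" unfolding w_def
      by (rule continuous_on_cases) (use cu u0 in auto)
    moreover have "cball 0 L \<union> - ?U = UNIV" by auto
    ultimately show ?thesis by simp
  qed
  have cV: "continuous_on UNIV V" unfolding V_def by (intro continuous_intros cw cg)
  have null: "negligible (frontier D)" using Dbdry by (rule negligible_frontier_C2alpha)
  have pair: "integral ?U (\<lambda>x. (if x \<in> D then \<sigma>p else \<sigma>m) * (G x \<bullet> grad \<phi> x))
      = - integral UNIV (\<lambda>x. V x * laplacian \<phi> x)" if "test_fun ?U \<phi>" for \<phi>
    unfolding V_def g_def w_def
    by (rule transmission_laplacian[OF G Ddom(1) null Ddom(3) L(2) open_ball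
          lip[unfolded g_def[abs_def]] cw[unfolded w_def[abs_def]] that])

  have super: "submean (\<lambda>x. - V x) a" if aU: "a \<in> ?U" for a
  proof -
    obtain r where r: "r > 0" "ball a r \<subseteq> ?U" using openE[OF open_ball aU] by blast
    have "integral UNIV (\<lambda>x. V x * laplacian (bump 1 a t) x) \<le> 0" if t: "0 < t" "t < r" for t
    proof -
      have "cball a t \<subseteq> ?U" using r(2) t by (auto simp: subset_eq)
      then have tf: "test_fun ?U (bump 1 a t)" using t(1) by (intro test_fun_bump)
      moreover have "bump 1 a t x \<ge> 0" for x by (simp add: bump_def flat_def)
      ultimately show ?thesis using sup[of "bump 1 a t"] pair[of "bump 1 a t"] by simp
    qed
    then show ?thesis by (rule weakly_superharmonic_submean[OF cV r(1)])
  qed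
  \<comment> \<open>Off the contact set the weak form is an equality, so the superharmonic criterion
    also applies to \<open>- V\<close>.\<close>
  have harm: "submean V a" if a: "a \<in> ?U" "u a > \<psi> a" for a
  proof -
    have "continuous_on ?U (\<lambda>x. u x - \<psi> x)"
      using cu psi_reg(2) by (intro continuous_intros) (auto intro: continuous_on_subset)
    then have "open (?U \<inter> (\<lambda>x. u x - \<psi> x) -` {0<..})" by (intro continuous_open_preimage) auto
    moreover have "?U \<inter> (\<lambda>x. u x - \<psi> x) -` {0<..} = {x \<in> ?U. u x > \<psi> x}" by auto
    ultimately have "open {x \<in> ?U. u x > \<psi> x}" by simp
    moreover have "a \<in> {x \<in> ?U. u x > \<psi> x}" using a by simp
    ultimately obtain r where r: "r > 0" "ball a r \<subseteq> {x \<in> ?U. u x > \<psi> x}" by (metis openE)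
    have "integral UNIV (\<lambda>x. - V x * laplacian (bump 1 a t) x) \<le> 0" if t: "0 < t" "t < r" for t
    proof -
      have "cball a t \<subseteq> ball a r" using t by auto
      then have "cball a t \<subseteq> {x \<in> ?U. u x > \<psi> x}" using r(2) by (rule subset_trans)
      then have tf: "test_fun {x \<in> ?U. u x > \<psi> x} (bump 1 a t)" using t(1) by (intro test_fun_bump)
      then have "test_fun ?U (bump 1 a t)" by (rule test_fun_mono) auto
      then show ?thesis using free[OF tf] pair[of "bump 1 a t"] by simp
    qed
    then have "submean (\<lambda>x. - (- V x)) a"
      by (intro weakly_superharmonic_submean[OF _ r(1)] continuous_on_minus cV)
    then show ?thesis by simp
  qed

  have Vout: "V x = 0" if "x \<notin> ?U" for x using that DU by (auto simp: V_def w_def g_def)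
  have VD: "V x = \<sigma>m * d + \<sigma>p * (u x - d)" if "x \<in> D" for x
    using that DU by (auto simp: V_def w_def g_def algebra_simps)
  have VU: "V x = \<sigma>m * u x" if "x \<in> ?U" "x \<notin> D" for x
    using that by (simp add: V_def w_def g_def)
  have frD: "frontier D \<subseteq> ?U" "frontier D \<inter> D = {}"
    using L(2) Ddom(1) by (auto simp: frontier_def interior_open)
  have Vfr: "V x = \<sigma>m * d" if "x \<in> frontier D" for x
  proof -
    have "x \<in> ?U" "x \<notin> D" using that frD by blast+
    then show ?thesis using VU that u_bd(2) by simp
  qed
  have "D \<noteq> UNIV" using Ddom(3) by auto
  then obtain p where p: "p \<in> frontier D" using Ddom(4) by (metis frontier_eq_empty empty_iff ex_in_conv)
  have cV': "continuous_on UNIV (\<lambda>x. - V x)" using cV by (rule continuous_on_minus)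
  have sd: "\<sigma>m * d > 0" using sig(2) u_bd(1) by simp
  have frU: "x \<notin> ?U" if "x \<in> frontier ?U" for x
    using that by (simp add: frontier_def interior_open)

  have Vnonneg: "V x \<ge> 0" if "x \<in> ?U" for x
    using submean_weak_maximum[OF cV' open_ball bounded_ball super _ that, of 0] frU Vout by fastforce
  \<comment> \<open>A zero inside the ball would be a minimum, and \<open>V\<close> would then
    vanish at \<open>p\<close> as well, where it equals \<open>\<sigma>m * d\<close>.\<close>
  have Vpos: "V x > 0" if x: "x \<in> ?U" for x
  proof (rule ccontr)
    assume "\<not> V x > 0"
    then have "V x = 0" using Vnonneg[OF x] by simp
    moreover have "- V y \<le> - V x" if "y \<in> ?U" for y using Vnonneg[OF that] \<open>V x = 0\<close> by simp
    ultimately have "- V p = - V x"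
      using p frD(1) by (intro submean_strong_maximum[OF cV' open_ball connected_ball super _ x]) auto
    then show False using \<open>V x = 0\<close> Vfr[OF p] sig(2) u_bd(1) by simp
  qed
  \<comment> \<open>Minimum principle on \<open>D\<close> itself, where all boundary values are
    \<open>\<sigma>m * d\<close>; it yields \<open>u \<ge> d\<close> in \<open>D\<close>.\<close>
  have VDge: "V x \<ge> \<sigma>m * d" if "x \<in> D" for x
    using submean_weak_maximum[OF cV' Ddom(1,3) super _ that, of "- (\<sigma>m * d)"] DU Vfr by fastforce
  have upos: "u x > 0" if "x \<in> ?U" for x
  proof (cases "x \<in> D")
    case True
    then have "\<sigma>p * (u x - d) \<ge> 0" using VD VDge by fastforce
    then show ?thesis using sig(1) u_bd(1) by (simp add: zero_le_mult_iff)
  next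
    case False
    then show ?thesis using Vpos[OF that] VU[OF that] sig(2) by (simp add: zero_less_mult_iff)
  qed
  have \<psi>D: "\<psi> x \<le> 0" if "x \<notin> D" for x
  proof (rule ccontr)
    assume "\<not> \<psi> x \<le> 0"
    then have "x \<in> closure {x. \<psi> x > 0}" using closure_subset by fastforce
    then show False using psi_supp that by blast
  qed
  have offD: "u x > \<psi> x" if "x \<in> ?U" "x \<notin> D" for x
    using upos[OF that(1)] \<psi>D[OF that(2)] by simp

  have rot: "V (R x) \<le> V x" if R: "orthogonal_transformation R" for R x
  proof (rule ccontr)
    assume asm: "\<not> V (R x) \<le> V x"
    have nR: "norm (R y) = norm y" for y using R by (rule orthogonal_transformation_norm)
    have cR: "continuous_on UNIV R"
      using R orthogonal_transformation_linear linear_continuous_on linear_conv_bounded_linear by blast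
    have cVR: "continuous_on UNIV (\<lambda>y. V (R y))" by (rule continuous_on_compose2[OF cV cR]) auto
    \<comment> \<open>\<open>V\<close> vanishes outside the ball and \<open>R\<close> preserves
      norms, so \<Omega> is bounded; at its frontier the strict inequality fails, which supplies the
      boundary bound.\<close>
    define \<Omega> where "\<Omega> = {y. V y < V (R y)}"
    have "open \<Omega>" unfolding \<Omega>_def using cV cVR by (rule open_Collect_less)
    have \<Omega>U: "y \<in> ?U" if "y \<in> \<Omega>" for y
    proof (rule ccontr)
      assume "y \<notin> ?U"
      moreover from this have "R y \<notin> ?U" by (simp add: nR)
      ultimately show False using that Vout by (simp add: \<Omega>_def)
    qed
    have sub: "submean (\<lambda>y. V (R y) + - V y) a" if a: "a \<in> \<Omega>" for a
    proof (rule submean_add[OF cVR cV' _ super[OF \<Omega>U[OF a]]])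
      have RU: "R a \<in> ?U" using \<Omega>U[OF a] by (simp add: nR)
      \<comment> \<open>At contact, \<open>u (R a) = \<psi> (R a) = \<psi> a \<le> u a\<close>.
        Positivity of \<open>u\<close> puts both points in \<open>D\<close>, where \<open>V\<close>
        is one fixed increasing function of \<open>u\<close>, against
        \<open>a \<in> \<Omega>\<close>.\<close>
      have "u (R a) > \<psi> (R a)"
      proof (rule ccontr)
        assume "\<not> u (R a) > \<psi> (R a)"
        then have c: "u (R a) = \<psi> (R a)" using u\<psi>[OF RU] by simp
        have RD: "R a \<in> D" using offD[OF RU] c by force
        have "\<psi> (R a) = \<psi> a" using psi_rad nR[of a] unfolding radial_def by blast
        moreover have "\<psi> (R a) > 0" using upos[OF RU] c by simp
        ultimately have "a \<in> D" using \<psi>D[of a] by (metis not_less)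
        have "u (R a) \<le> u a" using u\<psi>[OF \<Omega>U[OF a]] c \<open>\<psi> (R a) = \<psi> a\<close> by simp
        then have "V (R a) \<le> V a" using VD[OF RD] VD[OF \<open>a \<in> D\<close>] sig(1) by simp
        then show False using a by (simp add: \<Omega>_def)
      qed
      then show "submean (\<lambda>y. V (R y)) a" by (intro submean_orthogonal[OF cV R] harm RU)
    qed
    have "bounded \<Omega>" by (rule bounded_subset[OF bounded_ball]) (rule subsetI, rule \<Omega>U)
    have fr: "V (R y) + - V y \<le> 0" if "y \<in> frontier \<Omega>" for y
    proof -
      have "y \<notin> \<Omega>" using that \<open>open \<Omega>\<close> by (simp add: frontier_def interior_open)
      then show ?thesis by (simp add: \<Omega>_def)
    qed
    have "x \<in> \<Omega>" using asm by (simp add: \<Omega>_def)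
    have "V (R x) + - V x \<le> 0"
      by (rule submean_weak_maximum[OF continuous_on_add[OF cVR cV'] \<open>open \<Omega>\<close> \<open>bounded \<Omega>\<close>
            _ _ \<open>x \<in> \<Omega>\<close>]) (erule sub, erule fr)
    then show False using asm by simp
  qed
  have Vrad: "V x = V y" if "norm x = norm y" for x y
  proof -
    have "V a \<le> V b" if ab: "norm b = norm a" for a b
    proof -
      obtain R where "orthogonal_transformation R" "R b = a"
        using orthogonal_transformation_exists[OF ab] by blast
      then show ?thesis using rot by blast
    qed
    then show ?thesis using that by (simp add: order_antisym)
  qed

  have Vle: "V x \<le> \<sigma>m * d" if xD: "x \<notin> D" for x
  proof (cases "x \<in> ?U - closure D")
    case True
    let ?\<Omega> = "?U - closure D"
    have "open ?\<Omega>" by (intro open_Diff) auto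
    moreover have "submean V a" if "a \<in> ?\<Omega>" for a
      using that closure_subset[of D] by (intro harm offD) auto
    \<comment> \<open>The frontier of the outer region lies on the interface or outside the open
      ball, where \<open>V\<close> is \<open>\<sigma>m * d\<close> or 0.\<close>
    moreover have "V y \<le> \<sigma>m * d" if y: "y \<in> frontier ?\<Omega>" for y
    proof -
      have y': "y \<in> closure ?\<Omega>" "y \<notin> ?\<Omega>" using y \<open>open ?\<Omega>\<close> by (auto simp: frontier_def interior_open)
      have "D \<inter> ?\<Omega> = {}" using closure_subset by blast
      then have "D \<inter> closure ?\<Omega> = {}" using Ddom(1) by (simp add: open_Int_closure_eq_empty)
      then have "y \<notin> D" using y' by blast
      then have "y \<notin> ?U \<or> y \<in> frontier D" using y' Ddom(1) by (auto simp: frontier_def interior_open)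
      then show ?thesis using Vout[of y] Vfr[of y] sd by auto
    qed
    ultimately show ?thesis
      using submean_weak_maximum[OF cV, of ?\<Omega> "\<sigma>m * d" x] True by (auto intro: bounded_subset[OF bounded_ball])
  next
    case False
    then have "x \<notin> ?U \<or> x \<in> frontier D" using xD Ddom(1) by (auto simp: frontier_def interior_open)
    then show ?thesis using Vout[of x] Vfr[of x] sd by auto
  qed
  \<comment> \<open>Equality at one point would make \<open>V\<close> constant on \<open>D\<close>
    by the strong principle. Then \<open>V\<close> is submean in the whole ball, trivially in
    \<open>D\<close> and by the equation elsewhere, so \<open>V \<le> 0\<close>, contradicting
    \<open>\<sigma>m * d > 0\<close>.\<close>
  have Vgt: "V x > \<sigma>m * d" if x: "x \<in> D" for x
  proof (rule ccontr)
    assume "\<not> V x > \<sigma>m * d"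
    then have Vx: "V x = \<sigma>m * d" using VDge[OF x] by simp
    have const: "V y = \<sigma>m * d" if "y \<in> D" for y
    proof -
      have "- V y = - V x"
        using DU VDge Vx by (intro submean_strong_maximum[OF cV' Ddom(1,2) super _ x that]) auto
      then show ?thesis using Vx by simp
    qed
    have "submean V a" if a: "a \<in> ?U" for a
    proof (cases "a \<in> D")
      case True
      then obtain r where r: "r > 0" "ball a r \<subseteq> D" using Ddom(1) openE by blast
      have z: "(V y - V a) * mean_kernel a t y = 0" if t: "0 < t" "t < r" for y t
      proof (cases "y \<in> ball a t")
        case True
        then have "y \<in> D" using r(2) t by auto
        then show ?thesis using const \<open>a \<in> D\<close> by simp
      next
        case False
        then show ?thesis using t by (simp add: mean_kernel_eq_0)
      qed
      show ?thesis unfolding submean_def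
      proof (intro exI conjI allI impI)
        fix t assume "0 < t" "t < r"
        then show "0 \<le> integral UNIV (\<lambda>y. (V y - V a) * mean_kernel a t y)"
          by (subst z) simp_all
      qed (rule r(1))
    qed (use a offD harm in blast)
    then have "V x \<le> 0"
      using submean_weak_maximum[OF cV open_ball bounded_ball, of 0 L 0 x] frU Vout x DU by force
    then show False using Vx sig(2) u_bd(1) by (simp add: mult_le_0_iff)
  qed
  have Dsym: "y \<in> D" if "norm x = norm y" "x \<in> D" for x y
    using Vgt[OF that(2)] Vle[of y] Vrad[OF that(1)] by (metis not_less)
  have "\<exists>r>0. D = ball 0 r"
    by (rule rotation_invariant_domain_is_ball[OF Ddom]) (erule (1) Dsym)
  moreover have "radial u (cball 0 L)"
    unfolding radial_def
  proof (intro ballI impI)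
    fix x y assume xy: "x \<in> cball (0::real^'n) L" "y \<in> cball (0::real^'n) L" "norm x = norm y"
    have V: "V x = V y" using xy(3) by (rule Vrad)
    \<comment> \<open>\<open>Dsym\<close> excludes one point in \<open>D\<close> and one outside;
      the sphere is separate because there the boundary condition gives \<open>u\<close>
      directly.\<close>
    consider "x \<in> D" "y \<in> D" | "x \<notin> D" "y \<notin> D" "x \<in> ?U" "y \<in> ?U" | "norm x = L" "norm y = L"
      using Dsym[of x y] Dsym[of y x] xy by fastforce
    then show "u x = u y"
    proof cases
      case 1
      then show ?thesis using V VD sig(1) by simp
    next
      case 2
      then show ?thesis using V VU sig(2) by simp
    next
      case 3
      then show ?thesis using u0 by simp
    qed
  qed
  ultimately show ?thesis by blast
qed

end
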